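(* Let $p$ be a prime, let $L$ be a field of characteristic $p$ with a fixed algebraic closure $\overline{L}$, and let $\overline{\mathbb{F}}_p$ denote the algebraic closure of $\mathbb{F}_p$ inside $\overline{L}$. Let $f(x)=c_1x^{d_1}+c_2x^{d_2}\in\overline{\mathbb{F}}_p[x]$ with $c_1,c_2\in\overline{\mathbb{F}}_p^*$, $1\le d_1<d_2$, and write $d_i=p^{\ell_i}s_i$ with integers $\ell_i\ge0$ and $p\nmid s_i$. Assume $s_2>1$ and $p^{\ell_2}(s_2-1)<p^{\ell_1}(s_1-1)$. Let $\alpha,\beta\in L$. Then $\mathrm{Prep}(f;\alpha,\beta)$ is infinite if and only if $\alpha,\beta\in\overline{\mathbb{F}}_p$ or $f(\alpha)=f(\beta)$.
   Context: For $\lambda\in\overline{L}$ let $f_\lambda(x):=f(x)+\lambda$. An element is preperiodic under $f_\lambda$ if its forward orbit under $f_\lambda$ is finite. $\mathrm{Prep}(f;\alpha,\beta)$ is the set of $\lambda\in\overline{L}$ such that both $\alpha$ and $\beta$ are preperiodic under $f_\lambda$. *)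

theory Defs
  imports "HOL-Algebra.Algebraic_Closure_Type"
begin

text \<open>
  The algebraic closure of the prime field inside \<open>'a\<close>. The set \<open>\<int>\<close>, which is the image of
  \<open>of_int\<close>, is the prime field \<open>\<bbbF>\<^sub>p\<close> when \<open>'a\<close> has characteristic \<open>p > 0\<close>; only that case is
  intended. (The library predicate \<open>algebraic\<close>, which has the same shape, is restricted to
  characteristic 0.)
\<close>
definition Fp_bar :: "'a :: field set" where
  "Fp_bar = {x. \<exists>q. (\<forall>i. coeff q i \<in> \<int>) \<and> q \<noteq> 0 \<and> poly q x = 0}"

definition preperiodic :: "('a \<Rightarrow> 'a) \<Rightarrow> 'a \<Rightarrow> bool" where
  "preperiodic g x \<longleftrightarrow> finite (range (\<lambda>n. (g ^^ n) x))"

definition Prep :: "'a :: field poly \<Rightarrow> 'a \<Rightarrow> 'a \<Rightarrow> 'a set" where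
  "Prep f a b = {l. preperiodic (poly (f + [:l:])) a \<and> preperiodic (poly (f + [:l:])) b}"

end

theory Submission
  imports Defs
begin

text \<open>
  For a valuation ring \<open>V\<close> of the closure write \<open>x \<preceq> y\<close> for \<open>x \<in> y V\<close>. A preperiodic point that is
  a pole of \<open>V\<close> keeps its orbit in the disc \<open>u \<preceq> \<alpha>\<close>, so a parameter \<open>c\<close> in \<open>Prep(f; \<alpha>, \<beta>)\<close> has
  \<open>u = f(\<alpha>) + c\<close> close to a root of \<open>f(u) = f(\<alpha>)\<close>, and \<open>f(u) - f(u - \<delta>) \<preceq> \<alpha>\<close> where
  \<open>\<delta> = f(\<alpha>) - f(\<beta>)\<close>. Up to a power of Frobenius, \<open>f\<close> has a monomial derivative, which makes these
  roots distinct, more than \<open>1\<close> apart, and gives the product of their differences. If every root is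
  approached by some \<open>c\<close>, then interpolating \<open>f(u) - f(u - \<delta>)\<close> (again up to Frobenius) forces
  \<open>\<delta> \<preceq> \<alpha>\<^sup>-\<^sup>2\<close>; this is where the inequality on the exponents enters. If some root is missed, removing
  from the third iterate its roots near the missed one leaves a polynomial that is small on all
  \<open>u\<close>, and by Fekete's argument the discriminant of any large finite set of \<open>c\<close> is very small. So
  the discriminant times a suitable power of \<open>\<delta>\<close> is integral at every \<open>V\<close> and less than \<open>1\<close> at
  every pole of \<open>\<alpha>\<close>. It is therefore \<open>0\<close>, that is, \<open>\<delta> = 0\<close>. No product formula is needed, because
  the gain at one kind of place and the loss at the other are balanced by the same power of \<open>\<delta>\<close>.
\<close>

section \<open>Frobenius and the algebraic closure of the prime field\<close>

text \<open>Powers of Frobenius are additive, so the difference of two elements with equal images is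
  sent to \<open>0\<close>.\<close>

lemma power_CHAR_power_inj:
  fixes x y :: "'k :: field"
  assumes "Factorial_Ring.prime CHAR('k)" and "x ^ (CHAR('k) ^ n) = y ^ (CHAR('k) ^ n)"
  shows "x = y"
proof -
  have "((x - y) + y) ^ (CHAR('k) ^ n) = (x - y) ^ (CHAR('k) ^ n) + y ^ (CHAR('k) ^ n)"
    using assms(1) by (rule freshmans_dream') simp
  with assms(2) have "(x - y) ^ (CHAR('k) ^ n) = 0" by simp
  then show ?thesis by simp
qed

lemma power_fixed_iterate:
  fixes x :: "'k :: field"
  assumes "x ^ m = x"
  shows "x ^ (m ^ j) = x"
proof (induction j)
  case (Suc j)
  have "x ^ (m ^ Suc j) = (x ^ (m ^ j)) ^ m" by (simp add: power_mult [symmetric] mult.commute)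
  with Suc assms show ?case by simp
qed simp

lemma Ints_power_CHAR:
  fixes x :: "'k :: field"
  assumes p: "Factorial_Ring.prime CHAR('k)" and "x \<in> \<int>"
  shows "x ^ CHAR('k) = x"
proof -
  have nat: "(of_nat n :: 'k) ^ CHAR('k) = of_nat n" for n
    by (induction n) (use p in \<open>auto simp: freshmans_dream power_0_left prime_gt_0_nat\<close>)
  from assms(2) obtain i where i: "x = of_int i" by (auto elim: Ints_cases)
  show ?thesis
  proof (cases "i \<ge> 0")
    case True
    then obtain n where "i = int n" using nonneg_eq_int by blast
    with i nat show ?thesis by simp
  next
    case False
    then obtain n where "i = - int n" by (metis int_cases2 nle_le of_nat_0_le_iff)
    with i have "x = - of_nat n" by simp
    then show ?thesis using minus_power_prime_CHAR[OF refl p, of "of_nat n :: 'k"] nat by simp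
  qed
qed

lemma poly_power_CHAR_power:
  fixes q :: "'k :: field poly"
  assumes p: "Factorial_Ring.prime CHAR('k)" and "m = CHAR('k) ^ n"
    and "\<And>i. coeff q i ^ m = coeff q i"
  shows "poly q x ^ m = poly q (x ^ m)"
proof -
  have "poly q x ^ m = (\<Sum>i\<le>Polynomial.degree q. (coeff q i * x ^ i) ^ m)"
    unfolding poly_altdef by (rule freshmans_dream_sum'[OF p assms(2)])
  also have "\<dots> = poly q (x ^ m)"
    unfolding poly_altdef
    by (intro sum.cong) (simp_all add: power_mult_distrib assms(3) power_mult [symmetric] mult.commute)
  finally show ?thesis .
qed

text \<open>A power of Frobenius that fixes the coefficients of \<open>q\<close> maps roots to
  roots. There are finitely many roots, so the orbit of \<open>x\<close> repeats, and injectivity of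
  Frobenius strips the preperiod.\<close>

lemma periodic_Frobenius_of_root:
  fixes q :: "'k :: field poly"
  assumes p: "Factorial_Ring.prime CHAR('k)" and "n > 0"
    and coeffs: "\<And>i. coeff q i ^ (CHAR('k) ^ n) = coeff q i"
    and "q \<noteq> 0" and root: "poly q x = 0"
  shows "\<exists>k>0. x ^ (CHAR('k) ^ k) = x"
proof -
  define m where "m = CHAR('k) ^ n"
  have "poly q (x ^ (m ^ j)) = 0" for j
  proof (induction j)
    case (Suc j)
    have "poly q (x ^ (m ^ Suc j)) = poly q ((x ^ (m ^ j)) ^ m)"
      by (simp add: power_mult [symmetric] mult.commute)
    also have "\<dots> = poly q (x ^ (m ^ j)) ^ m"
      using poly_power_CHAR_power[OF p m_def] coeffs by (simp add: m_def)
    finally show ?case using Suc p by (simp add: m_def prime_gt_0_nat)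
  qed (use root in simp)
  then have "range (\<lambda>j. x ^ (m ^ j)) \<subseteq> {x. poly q x = 0}" by auto
  then have "finite (range (\<lambda>j. x ^ (m ^ j)))"
    using poly_roots_finite[OF \<open>q \<noteq> 0\<close>] finite_subset by blast
  then have "\<not> inj (\<lambda>j. x ^ (m ^ j))"
    using finite_imageD infinite_UNIV_nat by blast
  then obtain i j where ij: "i \<noteq> j" "x ^ (m ^ i) = x ^ (m ^ j)" by (auto simp: inj_on_def)
  have *: "\<exists>k>0. x ^ (CHAR('k) ^ k) = x" if "i < j" "x ^ (m ^ i) = x ^ (m ^ j)" for i j
  proof -
    from that(1) have "m ^ j = m ^ (j - i) * m ^ i" by (simp add: power_add [symmetric])
    with that(2) have "(x ^ (m ^ (j - i))) ^ (CHAR('k) ^ (n * i)) = x ^ (CHAR('k) ^ (n * i))"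
      by (simp add: m_def power_mult)
    then have "x ^ (m ^ (j - i)) = x" by (rule power_CHAR_power_inj[OF p])
    then have "x ^ (CHAR('k) ^ (n * (j - i))) = x" by (simp add: m_def power_mult)
    with \<open>n > 0\<close> that(1) show ?thesis by (intro exI[of _ "n * (j - i)"]) auto
  qed
  from ij show ?thesis by (cases "i < j") (auto intro: *[of i j] *[of j i])
qed

text \<open>Frobenius fixes coefficients in the prime field, which gives a period; conversely a
  period \<open>k\<close> makes \<open>x\<close> a root of
  \<open>X ^ (CHAR('k) ^ k) - X\<close>.\<close>

lemma Fp_bar_iff:
  fixes x :: "'k :: field"
  assumes p: "Factorial_Ring.prime CHAR('k)"
  shows "x \<in> Fp_bar \<longleftrightarrow> (\<exists>k>0. x ^ (CHAR('k) ^ k) = x)"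
proof
  assume "x \<in> Fp_bar"
  then obtain q where q: "\<And>i. coeff q i \<in> \<int>" "q \<noteq> 0" "poly q x = 0" by (auto simp: Fp_bar_def)
  show "\<exists>k>0. x ^ (CHAR('k) ^ k) = x"
    by (rule periodic_Frobenius_of_root[OF p, of 1 q]) (use q Ints_power_CHAR[OF p] in auto)
next
  assume "\<exists>k>0. x ^ (CHAR('k) ^ k) = x"
  then obtain k where k: "k > 0" "x ^ (CHAR('k) ^ k) = x" by auto
  define q where "q = Polynomial.monom (1::'k) (CHAR('k) ^ k) - Polynomial.monom 1 1"
  have "CHAR('k) ^ k > 1" using k p prime_gt_1_nat by (metis one_less_power)
  then have "coeff q (CHAR('k) ^ k) = 1" by (simp add: q_def)
  then have "q \<noteq> 0" by auto
  moreover have "coeff q i \<in> \<int>" for i by (simp add: q_def)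
  moreover have "poly q x = 0" using k by (simp add: q_def poly_monom)
  ultimately show "x \<in> Fp_bar" unfolding Fp_bar_def by blast
qed

lemma common_Frobenius_period:
  fixes A :: "'k :: field set"
  assumes p: "Factorial_Ring.prime CHAR('k)" and "finite A" and "A \<subseteq> Fp_bar"
  shows "\<exists>k>0. \<forall>x\<in>A. x ^ (CHAR('k) ^ k) = x"
  using assms(2,3)
proof (induction A)
  case (insert a A)
  then obtain k where k: "k > 0" "\<forall>x\<in>A. x ^ (CHAR('k) ^ k) = x" by auto
  from insert.prems obtain j where j: "j > 0" "a ^ (CHAR('k) ^ j) = a"
    using Fp_bar_iff[OF p, of a] by auto
  have "x ^ (CHAR('k) ^ (k * j)) = x" if "x \<in> insert a A" for x
  proof (cases "x = a")
    case True
    then show ?thesis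
      using power_fixed_iterate[OF j(2), of k]
      by (simp add: power_mult [symmetric] mult.commute)
  next
    case False
    with that k show ?thesis
      using power_fixed_iterate[of x "CHAR('k) ^ k" j] by (simp add: power_mult [symmetric])
  qed
  with k j show ?case by (intro exI[of _ "k * j"]) auto
qed (auto intro: exI[of _ 1])

lemma Ints_subset_Fp_bar: "x \<in> \<int> \<Longrightarrow> (x :: 'k :: field) \<in> Fp_bar"
  unfolding Fp_bar_def
  by (auto intro!: exI[of _ "[:- x, 1:]"] simp: coeff_pCons split: nat.splits)

lemma Fp_bar_inverse:
  fixes x :: "'k :: field"
  assumes p: "Factorial_Ring.prime CHAR('k)" and "x \<in> Fp_bar"
  shows "inverse x \<in> Fp_bar"
  using assms(2) by (auto simp: Fp_bar_iff[OF p] power_inverse)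

section \<open>Existence of valuation rings\<close>

locale unital_subring =
  fixes S :: "'k :: field set"
  assumes one_closed: "1 \<in> S"
    and diff_closed: "x \<in> S \<Longrightarrow> y \<in> S \<Longrightarrow> x - y \<in> S"
    and mult_closed: "x \<in> S \<Longrightarrow> y \<in> S \<Longrightarrow> x * y \<in> S"
begin

lemma zero_closed: "0 \<in> S"
  using diff_closed[OF one_closed one_closed] by simp

lemma uminus_closed: "x \<in> S \<Longrightarrow> - x \<in> S"
  using diff_closed[OF zero_closed, of x] by simp

lemma add_closed: "x \<in> S \<Longrightarrow> y \<in> S \<Longrightarrow> x + y \<in> S"
  using diff_closed[of x "- y"] uminus_closed by simp

lemma sum_closed: "(\<And>i. i \<in> A \<Longrightarrow> f i \<in> S) \<Longrightarrow> sum f A \<in> S"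
  by (induction A rule: infinite_finite_induct) (auto intro: add_closed zero_closed)

lemma power_closed: "x \<in> S \<Longrightarrow> x ^ n \<in> S"
  by (induction n) (auto intro: mult_closed one_closed)

lemma unital_subring_adjoin: "unital_subring {poly P z |P. \<forall>i. coeff P i \<in> S}" (is "unital_subring ?A")
proof
  show "1 \<in> ?A"
    by (rule CollectI, rule exI[of _ 1]) (auto simp: one_closed zero_closed coeff_1)
  show "x - y \<in> ?A" if "x \<in> ?A" "y \<in> ?A" for x y
  proof -
    from that obtain P Q where PQ: "x = poly P z" "y = poly Q z"
      and "\<forall>i. coeff P i \<in> S" "\<forall>i. coeff Q i \<in> S" by auto
    then have "\<forall>i. coeff (P - Q) i \<in> S" by (auto intro: diff_closed)
    with PQ show ?thesis by (intro CollectI exI[of _ "P - Q"]) auto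
  qed
  show "x * y \<in> ?A" if "x \<in> ?A" "y \<in> ?A" for x y
  proof -
    from that obtain P Q where PQ: "x = poly P z" "y = poly Q z"
      and "\<forall>i. coeff P i \<in> S" "\<forall>i. coeff Q i \<in> S" by auto
    then have "\<forall>i. coeff (P * Q) i \<in> S"
      by (auto simp: coeff_mult intro!: sum_closed mult_closed)
    with PQ show ?thesis by (intro CollectI exI[of _ "P * Q"]) auto
  qed
qed

lemma subset_adjoin: "S \<subseteq> {poly P z |P. \<forall>i. coeff P i \<in> S}"
proof
  fix s assume "s \<in> S"
  then show "s \<in> {poly P z |P. \<forall>i. coeff P i \<in> S}"
    by (intro CollectI exI[of _ "[:s:]"])
       (auto simp: coeff_pCons zero_closed split: nat.splits)
qed

lemma mem_adjoin: "z \<in> {poly P z |P. \<forall>i. coeff P i \<in> S}"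
  by (intro CollectI exI[of _ "[:0, 1:]"])
     (auto simp: coeff_pCons zero_closed one_closed split: nat.splits)

end

lemma unital_subring_Ints: "unital_subring (\<int> :: 'k :: field set)"
  by standard auto

locale valuation_ring = unital_subring V for V :: "'k :: field set" +
  assumes total: "x \<in> V \<or> inverse x \<in> V"

text \<open>
  Chevalley's argument: a subring that contains \<open>y\<close> and is maximal among those omitting
  \<open>inverse y\<close> is a valuation ring.
\<close>
locale maximal_omitting = unital_subring S for S :: "'k :: field set" +
  fixes y :: 'k
  assumes y: "y \<in> S" "y \<noteq> 0" "inverse y \<notin> S"
    and maximal: "unital_subring S' \<Longrightarrow> S \<subseteq> S' \<Longrightarrow> inverse y \<notin> S' \<Longrightarrow> S' = S"
begin

text \<open>The principal ideal generated by \<open>y\<close>. It is proper because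
  \<open>inverse y\<close> is not in \<open>S\<close>.\<close>

definition J where "J = (\<lambda>s. y * s) ` S"

lemma J_subset: "J \<subseteq> S"
  using y mult_closed by (auto simp: J_def)

lemma J_diff: "a \<in> J \<Longrightarrow> b \<in> J \<Longrightarrow> a - b \<in> J"
  unfolding J_def by (force simp: right_diff_distrib [symmetric] intro: diff_closed)

lemma J_zero: "0 \<in> J"
  unfolding J_def using zero_closed by force

lemma J_add: "a \<in> J \<Longrightarrow> b \<in> J \<Longrightarrow> a + b \<in> J"
  using J_diff[of a "0 - b"] J_diff[OF J_zero, of b] by simp

lemma J_mult: "a \<in> J \<Longrightarrow> s \<in> S \<Longrightarrow> s * a \<in> J"
  unfolding J_def using mult_closed by (force simp: ac_simps)

lemma one_notin_J: "1 \<notin> J"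
proof
  assume "1 \<in> J"
  then obtain s where "s \<in> S" "y * s = 1" by (auto simp: J_def)
  then show False using y by (metis inverse_unique)
qed

text \<open>The localisation \<open>T\<close> of \<open>S\<close> at the powers of
  \<open>1 - b\<close> still omits \<open>inverse y\<close>, so maximality gives
  \<open>T = S\<close>. Thus \<open>J\<close> lies in the Jacobson radical of
  \<open>S\<close>.\<close>

lemma unit_one_minus:
  assumes "b \<in> J"
  shows "inverse (1 - b) \<in> S"
proof -
  define T where "T = {a / (1 - b) ^ n |a n. a \<in> S}"
  have b: "b \<in> S" "1 - b \<in> S" "1 - b \<noteq> 0"
    using assms J_subset diff_closed one_closed one_notin_J by auto
  have "unital_subring T"
  proof
    show "1 \<in> T" unfolding T_def by (intro CollectI exI[of _ 1] exI[of _ 0]) (auto simp: one_closed)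
    show "u - v \<in> T" if uv: "u \<in> T" "v \<in> T" for u v
    proof -
      obtain a n c m where *: "u = a / (1 - b) ^ n" "a \<in> S" "v = c / (1 - b) ^ m" "c \<in> S"
        using uv by (auto simp: T_def)
      have "u - v = (a * (1 - b) ^ m - c * (1 - b) ^ n) / (1 - b) ^ (n + m)"
        using b(3) unfolding *(1,3) by (simp add: diff_frac_eq power_add)
      moreover have "a * (1 - b) ^ m - c * (1 - b) ^ n \<in> S"
        using * power_closed[OF b(2)] by (intro diff_closed mult_closed) auto
      ultimately show ?thesis unfolding T_def by blast
    qed
    show "u * v \<in> T" if uv: "u \<in> T" "v \<in> T" for u v
    proof -
      obtain a n c m where *: "u = a / (1 - b) ^ n" "a \<in> S" "v = c / (1 - b) ^ m" "c \<in> S"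
        using uv by (auto simp: T_def)
      have "u * v = (a * c) / (1 - b) ^ (n + m)" using * by (simp add: power_add)
      with * mult_closed show ?thesis unfolding T_def by blast
    qed
  qed
  moreover have "S \<subseteq> T"
    unfolding T_def by (intro subsetI CollectI) (metis div_by_1 power_0)
  moreover have "inverse y \<notin> T"
  proof
    assume "inverse y \<in> T"
    then obtain a n where an: "inverse y = a / (1 - b) ^ n" "a \<in> S" by (auto simp: T_def)
    \<comment> \<open>Powers of \<open>1 - b\<close> are congruent to \<open>1\<close> modulo
      \<open>J\<close>, whereas \<open>inverse y \<in> T\<close> would put one of them into
      \<open>J\<close>.\<close>
    have "1 - (1 - b) ^ n \<in> J"
    proof (induction n)
      case (Suc n)
      have "1 - (1 - b) ^ Suc n = (1 - (1 - b) ^ n) + (1 - b) ^ n * b" by (simp add: algebra_simps)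
      moreover have "(1 - b) ^ n * b \<in> J" using assms b by (intro J_mult power_closed) auto
      ultimately show ?case using Suc J_add by metis
    qed (simp add: J_zero)
    moreover have "(1 - b) ^ n = y * a" using an y b by (simp add: field_simps)
    then have "(1 - b) ^ n \<in> J" using an(2) by (auto simp: J_def)
    ultimately have "1 \<in> J" using J_add by fastforce
    with one_notin_J show False by simp
  qed
  ultimately have "T = S" by (intro maximal)
  moreover have "inverse (1 - b) \<in> T"
    unfolding T_def by (intro CollectI exI[of _ 1] exI[of _ "1::nat"]) (auto simp: one_closed field_simps)
  ultimately show ?thesis by simp
qed

text \<open>Such a relation says that \<open>J\<close> generates the unit ideal once
  \<open>z\<close> is adjoined to \<open>S\<close>; its degree bound drives the descent.\<close>

definition unit_rep where
  "unit_rep z n \<longleftrightarrow> (\<exists>P. Polynomial.degree P \<le> n \<and> (\<forall>i. coeff P i \<in> J) \<and> poly P z = 1)"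

text \<open>Adjoining \<open>z\<close> enlarges \<open>S\<close>, so by maximality the new ring
  contains \<open>inverse y\<close>. Multiplying by \<open>y\<close> moves the coefficients into
  \<open>J\<close>.\<close>

lemma unit_rep_exists:
  assumes "z \<notin> S"
  shows "\<exists>n. unit_rep z n"
proof -
  have "inverse y \<in> {poly P z |P. \<forall>i. coeff P i \<in> S}" (is "_ \<in> ?A")
  proof (rule ccontr)
    assume "inverse y \<notin> ?A"
    then have "?A = S" by (intro maximal unital_subring_adjoin subset_adjoin)
    with mem_adjoin[of z] assms show False by auto
  qed
  then obtain P where P: "inverse y = poly P z" "\<forall>i. coeff P i \<in> S" by auto
  have "poly (smult y P) z = 1" using P(1) y by (simp flip: P(1))
  moreover have "\<forall>i. coeff (smult y P) i \<in> J" using P(2) by (auto simp: J_def)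
  ultimately show ?thesis unfolding unit_rep_def by blast
qed

lemma unit_rep_pos: "unit_rep z n \<Longrightarrow> n > 0"
proof (rule ccontr)
  assume "unit_rep z n" "\<not> n > 0"
  then obtain P where P: "Polynomial.degree P = 0" "\<forall>i. coeff P i \<in> J" "poly P z = 1"
    by (auto simp: unit_rep_def)
  then have "coeff P 0 = 1" by (auto elim: degree_eq_zeroE)
  with P(2) one_notin_J show False by metis
qed

text \<open>The relation for \<open>inverse z\<close>, multiplied by \<open>z ^ m\<close> and
  divided by the unit \<open>1 - coeff Q 0\<close>, writes \<open>z ^ m\<close> as \<open>R\<close>
  at \<open>z\<close>, a combination of lower powers with coefficients in \<open>J\<close>.
  Substituting it into the top term of \<open>P\<close> lowers the degree.\<close>

lemma unit_rep_reduce: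
  assumes z: "z \<noteq> 0" and n: "unit_rep z n" and m: "unit_rep (inverse z) m" and "m \<le> n"
  shows "unit_rep z (n - 1)"
proof -
  obtain P where P: "Polynomial.degree P \<le> n" "\<forall>i. coeff P i \<in> J" "poly P z = 1"
    using n by (auto simp: unit_rep_def)
  obtain Q where Q: "Polynomial.degree Q \<le> m" "\<forall>i. coeff Q i \<in> J" "poly Q (inverse z) = 1"
    using m by (auto simp: unit_rep_def)
  note pos = unit_rep_pos[OF m]
  define c where "c = inverse (1 - coeff Q 0)"
  have c: "c \<in> S" "c * (1 - coeff Q 0) = 1"
    using Q(2) unit_one_minus one_notin_J by (auto simp: c_def) (metis eq_iff_diff_eq_0 left_inverse)
  define R where "R = (\<Sum>i<m. Polynomial.monom (c * coeff Q (m - i)) i)"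
  have coeff_R: "coeff R i = (if i < m then c * coeff Q (m - i) else 0)" for i
    by (simp add: R_def coeff_sum)
  have coeff_R_J: "coeff R i \<in> J" for i
    using c Q(2) by (auto simp: coeff_R J_zero intro: J_mult)
  have deg_R: "Polynomial.degree R \<le> m - 1"
    by (rule degree_le) (auto simp: coeff_R)
  have "1 = (\<Sum>j\<le>m. coeff Q j * inverse z ^ j)"
    unfolding Q(3) [symmetric] poly_altdef
    using Q(1) by (intro sum.mono_neutral_left) (auto simp: coeff_eq_0)
  also have "\<dots> = coeff Q 0 + (\<Sum>j=1..m. coeff Q j * inverse z ^ j)"
    by (simp add: sum.atMost_shift sum.atLeast1_atMost_eq lessThan_Suc_atMost)
  finally have "1 - coeff Q 0 = (\<Sum>j=1..m. coeff Q j * inverse z ^ j)"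
    by (metis add_diff_cancel_left')
  then have "c * (1 - coeff Q 0) = c * (\<Sum>j=1..m. coeff Q j * inverse z ^ j)" by simp
  then have "z ^ m = z ^ m * (c * (\<Sum>j=1..m. coeff Q j * inverse z ^ j))" using c(2) by simp
  also have "\<dots> = (\<Sum>j=1..m. c * coeff Q j * z ^ (m - j))"
    unfolding sum_distrib_left
    by (intro sum.cong) (use z in \<open>auto simp: power_diff field_simps\<close>)
  also have "\<dots> = (\<Sum>i<m. c * coeff Q (m - i) * z ^ i)"
    by (rule sum.reindex_bij_witness[of _ "\<lambda>i. m - i" "\<lambda>j. m - j"]) auto
  also have "\<dots> = poly R z" by (simp add: R_def poly_sum poly_monom)
  finally have R: "poly R z = z ^ m" ..
  define a where "a = coeff P n"
  define P' where "P' = (P - Polynomial.monom a n) + smult a (Polynomial.monom 1 (n - m) * R)"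
  have "poly P' z = 1"
    using P(3) \<open>m \<le> n\<close> by (simp add: P'_def poly_monom R power_add [symmetric])
  moreover have coeff': "coeff P' i = (coeff P i - (if i = n then a else 0)) +
      (if i < n - m then 0 else a * coeff R (i - (n - m)))" for i
    by (simp add: P'_def coeff_monom_mult)
  have "coeff P' i \<in> J" for i
  proof -
    have "a \<in> S" using P(2) J_subset by (auto simp: a_def)
    then show ?thesis
      using P(2) coeff_R_J unfolding coeff'
      by (intro J_add J_diff) (auto simp: J_zero a_def intro!: J_mult)
  qed
  moreover have "Polynomial.degree P' \<le> n - 1"
  proof (rule degree_le, intro allI impI)
    fix i assume "n - 1 < i"
    then have "coeff R (i - (n - m)) = 0" using \<open>m \<le> n\<close> pos by (auto simp: coeff_R)
    moreover have "coeff P i - (if i = n then a else 0) = 0"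
      using P(1) \<open>n - 1 < i\<close> by (auto simp: a_def intro: coeff_eq_0)
    ultimately show "coeff P' i = 0" by (simp add: coeff')
  qed
  ultimately show ?thesis unfolding unit_rep_def by blast
qed

sublocale valuation_ring S
proof
  fix z
  show "z \<in> S \<or> inverse z \<in> S"
  proof (rule ccontr)
    assume *: "\<not> (z \<in> S \<or> inverse z \<in> S)"
    then have "z \<noteq> 0" using zero_closed by auto
    \<comment> \<open>Both relations are taken of least degree; the one of larger degree could still
      be shortened by means of the other.\<close>
    define n m where "n = (LEAST n. unit_rep z n)" and "m = (LEAST n. unit_rep (inverse z) n)"
    have n: "unit_rep z n" and m: "unit_rep (inverse z) m"
      unfolding n_def m_def using * unit_rep_exists by (metis LeastI_ex)+
    show False
    proof (cases "m \<le> n")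
      case True
      from unit_rep_reduce[OF \<open>z \<noteq> 0\<close> n m this] have "n \<le> n - 1"
        unfolding n_def by (rule Least_le)
      with unit_rep_pos[OF n] show False by simp
    next
      case False
      then have "unit_rep (inverse z) (m - 1)"
        using unit_rep_reduce[of "inverse z" m n] \<open>z \<noteq> 0\<close> n m by simp
      then have "m \<le> m - 1" unfolding m_def by (rule Least_le)
      with unit_rep_pos[OF m] show False by simp
    qed
  qed
qed

end

text \<open>Zorn's lemma starts from the prime field with \<open>y = inverse x\<close> adjoined.
  That ring omits \<open>x\<close>, because \<open>x = P(y)\<close> would make \<open>y\<close> a
  root of \<open>X * P - 1\<close> and hence algebraic over the prime field.\<close>

lemma exists_valuation_ring:
  fixes x :: "'k :: field"
  assumes p: "Factorial_Ring.prime CHAR('k)" and x: "x \<notin> Fp_bar"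
  shows "\<exists>V. valuation_ring V \<and> x \<notin> V"
proof -
  have x0: "x \<noteq> 0" using x Ints_subset_Fp_bar[of 0] by auto
  define y where "y = inverse x"
  define \<A> where "\<A> = {S. unital_subring S \<and> y \<in> S \<and> x \<notin> S}"
  define S0 where "S0 = {poly P y |P. \<forall>i. coeff P i \<in> \<int>}"
  interpret Z: unital_subring "\<int> :: 'k set" by (rule unital_subring_Ints)
  have "x \<notin> S0"
  proof
    assume "x \<in> S0"
    then obtain P where P: "x = poly P y" "\<forall>i. coeff P i \<in> \<int>" by (auto simp: S0_def)
    define Q where "Q = pCons (- 1) P"
    have "poly Q y = 0" using P(1) x0 by (simp add: Q_def y_def)
    moreover have "Q \<noteq> 0" by (simp add: Q_def)
    moreover have "coeff Q i \<in> \<int>" for i using P(2) by (auto simp: Q_def coeff_pCons split: nat.splits)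
    ultimately have "y \<in> Fp_bar" unfolding Fp_bar_def by blast
    then have "x \<in> Fp_bar" using Fp_bar_inverse[OF p, of y] by (simp add: y_def)
    with x show False by simp
  qed
  then have "S0 \<in> \<A>"
    using Z.unital_subring_adjoin Z.mem_adjoin by (auto simp: \<A>_def S0_def)
  moreover have "\<Union>\<C> \<in> \<A>" if C: "\<C> \<noteq> {}" "subset.chain \<A> \<C>" for \<C>
  proof -
    have mem: "unital_subring S" "y \<in> S" "x \<notin> S" if "S \<in> \<C>" for S
      using that C(2) by (auto simp: \<A>_def subset_chain_def)
    have two: "\<exists>S\<in>\<C>. a \<in> S \<and> b \<in> S" if "a \<in> \<Union>\<C>" "b \<in> \<Union>\<C>" for a b
      using that C(2) unfolding subset_chain_def by blast
    have "unital_subring (\<Union>\<C>)"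
    proof
      show "1 \<in> \<Union>\<C>" using C(1) mem(1) unital_subring.one_closed by blast
      show "a - b \<in> \<Union>\<C>" if "a \<in> \<Union>\<C>" "b \<in> \<Union>\<C>" for a b
        using two[OF that] mem(1) unital_subring.diff_closed by blast
      show "a * b \<in> \<Union>\<C>" if "a \<in> \<Union>\<C>" "b \<in> \<Union>\<C>" for a b
        using two[OF that] mem(1) unital_subring.mult_closed by blast
    qed
    with C(1) mem show ?thesis by (auto simp: \<A>_def)
  qed
  ultimately obtain S where S: "S \<in> \<A>" "\<And>S'. S' \<in> \<A> \<Longrightarrow> S \<subseteq> S' \<Longrightarrow> S' = S"
    using subset_Zorn_nonempty[of \<A>] by (metis empty_iff)
  interpret unital_subring S using S(1) by (simp add: \<A>_def)
  have "maximal_omitting S y"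
    by unfold_locales (use S x0 in \<open>auto simp: \<A>_def y_def\<close>)
  then interpret maximal_omitting S y .
  show ?thesis using S(1) valuation_ring_axioms by (auto simp: \<A>_def)
qed

section \<open>The preorder of a valuation ring\<close>

context valuation_ring
begin

text \<open>Read this as: the absolute value of \<open>x\<close> is at most that of
  \<open>y\<close>. Divisibility takes the place of a value group, so valuation rings of any rank
  are covered.\<close>

definition vle (infix "\<preceq>" 50) where "x \<preceq> y \<longleftrightarrow> (\<exists>c\<in>V. x = c * y)"
definition vlt (infix "\<prec>" 50) where "x \<prec> y \<longleftrightarrow> \<not> y \<preceq> x"
definition veq (infix "\<asymp>" 50) where "x \<asymp> y \<longleftrightarrow> x \<preceq> y \<and> y \<preceq> x"

lemma vle_refl [simp]: "x \<preceq> x"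
  unfolding vle_def using one_closed by force

lemma vle_trans [trans]: "x \<preceq> y \<Longrightarrow> y \<preceq> z \<Longrightarrow> x \<preceq> z"
  unfolding vle_def using mult_closed by (metis mult.assoc)

lemma zero_vle [simp]: "0 \<preceq> x"
  unfolding vle_def using zero_closed by force

lemma vle_zero_iff [simp]: "x \<preceq> 0 \<longleftrightarrow> x = 0"
  unfolding vle_def using zero_closed by auto

lemma vle_one_iff: "x \<preceq> 1 \<longleftrightarrow> x \<in> V"
  unfolding vle_def by simp

lemma vle_total: "x \<preceq> y \<or> y \<preceq> x"
proof (cases "x = 0 \<or> y = 0")
  case False
  then have "x = (x / y) * y" "y = inverse (x / y) * x" by (auto simp: field_simps)
  with total[of "x / y"] show ?thesis unfolding vle_def by metis
qed auto

lemma not_vle: "\<not> x \<preceq> y \<longleftrightarrow> y \<prec> x"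
  and not_vlt: "\<not> x \<prec> y \<longleftrightarrow> y \<preceq> x"
  unfolding vlt_def by auto

lemma vlt_imp_vle: "x \<prec> y \<Longrightarrow> x \<preceq> y"
  unfolding vlt_def using vle_total by blast

lemma vlt_irrefl [simp]: "\<not> x \<prec> x"
  unfolding vlt_def by simp

lemma vlt_vle_trans [trans]: "x \<prec> y \<Longrightarrow> y \<preceq> z \<Longrightarrow> x \<prec> z"
  unfolding vlt_def using vle_trans by blast

lemma vle_vlt_trans [trans]: "x \<preceq> y \<Longrightarrow> y \<prec> z \<Longrightarrow> x \<prec> z"
  unfolding vlt_def using vle_trans by blast

lemma vlt_trans [trans]: "x \<prec> y \<Longrightarrow> y \<prec> z \<Longrightarrow> x \<prec> z"
  using vlt_vle_trans vlt_imp_vle by blast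

lemma veq_refl [simp]: "x \<asymp> x"
  and veq_sym: "x \<asymp> y \<Longrightarrow> y \<asymp> x"
  and veq_imp_vle: "x \<asymp> y \<Longrightarrow> x \<preceq> y"
  and veq_trans [trans]: "x \<asymp> y \<Longrightarrow> y \<asymp> z \<Longrightarrow> x \<asymp> z"
  and veq_vle_trans [trans]: "x \<asymp> y \<Longrightarrow> y \<preceq> z \<Longrightarrow> x \<preceq> z"
  and vle_veq_trans [trans]: "x \<preceq> y \<Longrightarrow> y \<asymp> z \<Longrightarrow> x \<preceq> z"
  and veq_vlt_trans [trans]: "x \<asymp> y \<Longrightarrow> y \<prec> z \<Longrightarrow> x \<prec> z"
  and vlt_veq_trans [trans]: "x \<prec> y \<Longrightarrow> y \<asymp> z \<Longrightarrow> x \<prec> z"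
  unfolding veq_def using vle_trans vlt_vle_trans vle_vlt_trans by (blast intro: vle_refl)+

lemma vlt_nonzero: "x \<prec> y \<Longrightarrow> y \<noteq> 0"
  by (auto simp: vlt_def)

lemma zero_vlt_iff [simp]: "0 \<prec> x \<longleftrightarrow> x \<noteq> 0"
  by (auto simp: vlt_def)

lemma veq_zero_iff [simp]: "x \<asymp> 0 \<longleftrightarrow> x = 0" "0 \<asymp> x \<longleftrightarrow> x = 0"
  by (auto simp: veq_def)

lemma vle_add: "x \<preceq> z \<Longrightarrow> y \<preceq> z \<Longrightarrow> x + y \<preceq> z"
  unfolding vle_def using add_closed by (metis distrib_right)

lemma vle_uminus [simp]: "- x \<preceq> y \<longleftrightarrow> x \<preceq> y"
  unfolding vle_def using uminus_closed by (metis minus_minus minus_mult_left)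

lemma vle_uminus' [simp]: "x \<preceq> - y \<longleftrightarrow> x \<preceq> y"
  unfolding vle_def using uminus_closed by (metis minus_minus minus_mult_commute)

lemma vle_diff: "x \<preceq> z \<Longrightarrow> y \<preceq> z \<Longrightarrow> x - y \<preceq> z"
  using vle_add[of x z "- y"] by simp

lemma vle_sum: "(\<And>i. i \<in> A \<Longrightarrow> f i \<preceq> z) \<Longrightarrow> sum f A \<preceq> z"
  by (induction A rule: infinite_finite_induct) (auto intro: vle_add)

lemma vlt_add: "x \<prec> z \<Longrightarrow> y \<prec> z \<Longrightarrow> x + y \<prec> z"
  using vle_total[of x y] vle_add[of x y y] vle_add[of x x y] vle_vlt_trans by (metis vle_refl)

lemma vlt_diff: "x \<prec> z \<Longrightarrow> y \<prec> z \<Longrightarrow> x - y \<prec> z"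
  using vlt_add[of x z "- y"] by (simp add: vlt_def)

lemma vlt_sum: "z \<noteq> 0 \<Longrightarrow> (\<And>i. i \<in> A \<Longrightarrow> f i \<prec> z) \<Longrightarrow> sum f A \<prec> z"
  by (induction A rule: infinite_finite_induct) (auto intro: vlt_add)

lemma vle_mult: "a \<preceq> b \<Longrightarrow> c \<preceq> d \<Longrightarrow> a * c \<preceq> b * d"
proof -
  assume "a \<preceq> b" "c \<preceq> d"
  then obtain s t where "s \<in> V" "t \<in> V" "a = s * b" "c = t * d" by (auto simp: vle_def)
  then show ?thesis unfolding vle_def by (intro bexI[of _ "s * t"] mult_closed) (auto simp: ac_simps)
qed

lemma vle_power: "a \<preceq> b \<Longrightarrow> a ^ n \<preceq> b ^ n"
  by (induction n) (auto intro: vle_mult)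

lemma vle_prod: "(\<And>i. i \<in> A \<Longrightarrow> f i \<preceq> g i) \<Longrightarrow> prod f A \<preceq> prod g A"
  by (induction A rule: infinite_finite_induct) (auto intro: vle_mult)

lemma vle_prod_mset: "(\<And>i. i \<in># A \<Longrightarrow> f i \<preceq> g i) \<Longrightarrow> (\<Prod>i\<in>#A. f i) \<preceq> (\<Prod>i\<in>#A. g i)"
  by (induction A) (auto intro: vle_mult)

lemma vle_mult_cancel_right: "c \<noteq> 0 \<Longrightarrow> a * c \<preceq> b * c \<longleftrightarrow> a \<preceq> b"
  unfolding vle_def by (simp add: mult.assoc [symmetric])

lemma vle_mult_cancel_left: "c \<noteq> 0 \<Longrightarrow> c * a \<preceq> c * b \<longleftrightarrow> a \<preceq> b"
  using vle_mult_cancel_right[of c a b] by (simp add: mult.commute)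

lemma vlt_mult_cancel_right: "c \<noteq> 0 \<Longrightarrow> a * c \<prec> b * c \<longleftrightarrow> a \<prec> b"
  unfolding vlt_def by (simp add: vle_mult_cancel_right)

lemma vlt_mult_cancel_left: "c \<noteq> 0 \<Longrightarrow> c * a \<prec> c * b \<longleftrightarrow> a \<prec> b"
  unfolding vlt_def by (simp add: vle_mult_cancel_left)

lemma vlt_mult_vle: "a \<prec> b \<Longrightarrow> c \<preceq> d \<Longrightarrow> d \<noteq> 0 \<Longrightarrow> a * c \<prec> b * d"
  using vle_mult[of a a c d] vlt_mult_cancel_right[of d a b] vle_vlt_trans by auto

lemma vle_mult_vlt: "a \<preceq> b \<Longrightarrow> c \<prec> d \<Longrightarrow> b \<noteq> 0 \<Longrightarrow> a * c \<prec> b * d"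
  using vlt_mult_vle[of c d a b] by (simp add: mult.commute)

lemma vlt_mult: "a \<prec> b \<Longrightarrow> c \<prec> d \<Longrightarrow> a * c \<prec> b * d"
  using vlt_mult_vle[of a b c d] vlt_imp_vle vlt_nonzero by blast

lemma vlt_power: "a \<prec> b \<Longrightarrow> n > 0 \<Longrightarrow> a ^ n \<prec> b ^ n"
proof (induction n)
  case (Suc n)
  then show ?case by (cases "n = 0") (auto intro: vlt_mult)
qed simp

lemma vle_power_cancel: "a ^ n \<preceq> b ^ n \<Longrightarrow> n > 0 \<Longrightarrow> a \<preceq> b"
  using vlt_power[of b a n] unfolding vlt_def by blast

lemma vlt_power_cancel: "a ^ n \<prec> b ^ n \<Longrightarrow> a \<prec> b"
  using vle_power[of b a n] unfolding vlt_def by blast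

lemma veq_power_cancel: "a ^ n \<asymp> b ^ n \<Longrightarrow> n > 0 \<Longrightarrow> a \<asymp> b"
  unfolding veq_def using vle_power_cancel by blast

lemma veq_mult: "a \<asymp> b \<Longrightarrow> c \<asymp> d \<Longrightarrow> a * c \<asymp> b * d"
  unfolding veq_def by (auto intro: vle_mult)

lemma veq_power: "a \<asymp> b \<Longrightarrow> a ^ n \<asymp> b ^ n"
  unfolding veq_def by (auto intro: vle_power)

lemma veq_prod: "(\<And>i. i \<in> A \<Longrightarrow> f i \<asymp> g i) \<Longrightarrow> prod f A \<asymp> prod g A"
  unfolding veq_def by (auto intro: vle_prod)

lemma veq_prod_mset: "(\<And>i. i \<in># A \<Longrightarrow> f i \<asymp> g i) \<Longrightarrow> (\<Prod>i\<in>#A. f i) \<asymp> (\<Prod>i\<in>#A. g i)"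
  unfolding veq_def by (auto intro: vle_prod_mset)

lemma veq_minus: "- x \<asymp> x"
  unfolding veq_def by simp

lemma veq_minus_commute: "x - y \<asymp> y - x"
  using veq_minus[of "y - x"] by simp

text \<open>The larger of two terms decides the size of a sum: if \<open>x + y\<close> were smaller
  than \<open>x\<close>, then so would be \<open>(x + y) - y\<close>.\<close>

lemma veq_add: "y \<prec> x \<Longrightarrow> x + y \<asymp> x"
proof -
  assume y: "y \<prec> x"
  have "x + y \<preceq> x" using y by (intro vle_add) (auto dest: vlt_imp_vle)
  moreover have "x \<preceq> x + y"
  proof (rule ccontr)
    assume "\<not> x \<preceq> x + y"
    then have "(x + y) - y \<prec> x" using y by (intro vlt_diff) (auto simp: not_vle)
    then show False by simp
  qed
  ultimately show ?thesis by (simp add: veq_def)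
qed

lemma veq_diff: "y \<prec> x \<Longrightarrow> x - y \<asymp> x"
  using veq_add[of "- y" x] by (simp add: vlt_def)

lemma one_vle_power: "1 \<preceq> x \<Longrightarrow> 1 \<preceq> x ^ n"
  using vle_power[of 1 x n] by simp

lemma one_vlt_power: "1 \<prec> x \<Longrightarrow> n > 0 \<Longrightarrow> 1 \<prec> x ^ n"
  using vlt_power[of 1 x n] by simp

lemma vle_power_mono: "1 \<preceq> x \<Longrightarrow> m \<le> n \<Longrightarrow> x ^ m \<preceq> x ^ n"
  using vle_mult[of "x ^ m" "x ^ m" 1 "x ^ (n - m)"] one_vle_power[of x "n - m"]
  by (simp add: power_add [symmetric])

lemma vlt_power_mono: "1 \<prec> x \<Longrightarrow> m < n \<Longrightarrow> x ^ m \<prec> x ^ n"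
  using vle_mult_vlt[of "x ^ m" "x ^ m" 1 "x ^ (n - m)"] one_vlt_power[of x "n - m"] vlt_nonzero[of 1 x]
  by (simp add: power_add [symmetric])

lemma power_vle_iff: "1 \<prec> x \<Longrightarrow> x ^ m \<preceq> x ^ n \<longleftrightarrow> m \<le> n"
  using vle_power_mono[of x m n] vlt_power_mono[of x n m] vlt_imp_vle[of 1 x]
  by (auto simp: vlt_def not_le [symmetric])

lemma power_veq_imp_eq: "1 \<prec> x \<Longrightarrow> x ^ m \<asymp> x ^ n \<Longrightarrow> m = n"
  by (simp add: veq_def power_vle_iff)

lemma vle_power_self: "1 \<preceq> x \<Longrightarrow> n > 0 \<Longrightarrow> x \<preceq> x ^ n"
  using vle_power_mono[of x 1 n] by simp

lemma veq_one_if_power_eq_one: "x ^ n = 1 \<Longrightarrow> n > 0 \<Longrightarrow> x \<asymp> 1"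
  using veq_power_cancel[of x n 1] by simp

text \<open>A nonzero Frobenius-periodic element is a root of unity, hence a unit of every valuation
  ring.\<close>

lemma Fp_bar_veq_one:
  assumes p: "Factorial_Ring.prime CHAR('k)" and "x \<in> Fp_bar" "x \<noteq> 0"
  shows "x \<asymp> 1"
proof -
  obtain k where k: "k > 0" "x ^ (CHAR('k) ^ k) = x" using assms(2) Fp_bar_iff[OF p] by auto
  have gt: "CHAR('k) ^ k > 1" using k p prime_gt_1_nat by (metis one_less_power)
  have "x * x ^ (CHAR('k) ^ k - 1) = x"
    using k gt by (metis less_imp_not_eq2 power_eq_if zero_less_one less_trans)
  then have "x ^ (CHAR('k) ^ k - 1) = 1" using \<open>x \<noteq> 0\<close> by simp
  with gt show ?thesis by (intro veq_one_if_power_eq_one) auto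
qed

lemma Fp_bar_subset:
  assumes p: "Factorial_Ring.prime CHAR('k)" and "x \<in> Fp_bar"
  shows "x \<in> V"
  using Fp_bar_veq_one[OF p assms(2)] by (cases "x = 0") (auto simp: zero_closed vle_one_iff veq_def)

end

section \<open>Interpolation and discriminants\<close>

lemma degree_prod_linear:
  fixes A :: "'k :: field set"
  shows "Polynomial.degree (\<Prod>z\<in>A. [:- z, 1:]) = card A"
    and "Polynomial.lead_coeff (\<Prod>z\<in>A. [:- z, 1:]) = 1"
  by (simp add: degree_prod_eq_sum_degree, simp only: lead_coeff_prod, simp)

text \<open>\<open>P\<close> equals its Lagrange interpolant, as both have degree below
  \<open>card S\<close> and agree on \<open>S\<close>; compare the coefficients in degree
  \<open>card S - 1\<close>.\<close>

lemma lagrange_leading_coeff: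
  fixes P :: "'k :: field poly"
  assumes "finite S" and deg: "Polynomial.degree P < card S"
  shows "(\<Sum>y\<in>S. poly P y / (\<Prod>z\<in>S - {y}. y - z)) = coeff P (card S - 1)"
proof -
  define c where "c = (\<lambda>y. poly P y / (\<Prod>z\<in>S - {y}. y - z))"
  define B where "B = (\<lambda>y. \<Prod>z\<in>S - {y}. [:- z, 1:])"
  define L where "L = (\<Sum>y\<in>S. smult (c y) (B y))"
  have B: "Polynomial.degree (B y) = card S - 1" "coeff (B y) (card S - 1) = 1" if "y \<in> S" for y
    using degree_prod_linear[of "S - {y}"] that \<open>finite S\<close> by (auto simp: B_def)
  have poly_B: "poly (B y) x = (\<Prod>z\<in>S - {y}. x - z)" for x y
    by (simp add: B_def poly_prod)
  have "poly L x = poly P x" if "x \<in> S" for x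
  proof -
    have "poly L x = (\<Sum>y\<in>S. c y * (\<Prod>z\<in>S - {y}. x - z))"
      by (simp add: L_def poly_sum poly_B)
    also have "\<dots> = (\<Sum>y\<in>{x}. c y * (\<Prod>z\<in>S - {y}. x - z))"
      using that \<open>finite S\<close> by (intro sum.mono_neutral_right) auto
    also have "\<dots> = poly P x" using \<open>finite S\<close> by (simp add: c_def)
    finally show ?thesis .
  qed
  moreover have "Polynomial.degree L < card S"
  proof -
    have "Polynomial.degree L \<le> card S - 1"
      unfolding L_def by (intro degree_sum_le) (use \<open>finite S\<close> B in \<open>auto intro: order.trans[OF degree_smult_le]\<close>)
    with deg show ?thesis by simp
  qed
  ultimately have "L = P" using deg by (intro poly_eqI_degree[of S]) auto
  then have "coeff P (card S - 1) = (\<Sum>y\<in>S. c y * coeff (B y) (card S - 1))"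
    by (auto simp: L_def coeff_sum)
  also have "\<dots> = (\<Sum>y\<in>S. c y)" by (intro sum.cong refl) (simp only: B mult_1_right)
  finally show ?thesis by (simp add: c_def)
qed

text \<open>Ordered pairs give the usual discriminant up to sign, which affects neither size nor
  vanishing.\<close>

definition discriminant :: "'k :: field set \<Rightarrow> 'k" where
  "discriminant S = (\<Prod>x\<in>S. \<Prod>y\<in>S - {x}. x - y)"

lemma discriminant_nonzero: "finite S \<Longrightarrow> discriminant S \<noteq> 0"
  by (auto simp: discriminant_def)

lemma discriminant_remove:
  assumes "finite S" "y \<in> S"
  shows "discriminant S =
    discriminant (S - {y}) * ((\<Prod>z\<in>S - {y}. y - z) * (\<Prod>z\<in>S - {y}. z - y))"
proof -
  have "discriminant S = (\<Prod>z\<in>S - {y}. y - z) * (\<Prod>x\<in>S - {y}. \<Prod>z\<in>S - {x}. x - z)"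
    unfolding discriminant_def using assms by (simp add: prod.remove)
  also have "(\<Prod>x\<in>S - {y}. \<Prod>z\<in>S - {x}. x - z) =
      (\<Prod>x\<in>S - {y}. (x - y) * (\<Prod>z\<in>S - {y} - {x}. x - z))"
  proof (intro prod.cong refl)
    fix x assume "x \<in> S - {y}"
    then have "(\<Prod>z\<in>S - {x}. x - z) = (x - y) * (\<Prod>z\<in>S - {x} - {y}. x - z)"
      using assms by (intro prod.remove) auto
    also have "S - {x} - {y} = S - {y} - {x}" by auto
    finally show "(\<Prod>z\<in>S - {x}. x - z) = (x - y) * (\<Prod>z\<in>S - {y} - {x}. x - z)" .
  qed
  finally show ?thesis by (simp add: prod.distrib discriminant_def ac_simps)
qed

context valuation_ring
begin

text \<open>
  Fekete's bound: interpolating \<open>h n\<close> at \<open>n + 1\<close> points of \<open>S\<close> singles out a point whose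
  distances to the others multiply to at most \<open>b n\<close>; remove it and repeat.
\<close>
lemma discriminant_vle:
  fixes h :: "nat \<Rightarrow> 'k poly"
  assumes "finite S"
    and h: "\<And>j. Polynomial.degree (h j) = j" "\<And>j. coeff (h j) j = 1"
    and "\<And>j u. u \<in> S \<Longrightarrow> poly (h j) u \<preceq> b j"
  shows "discriminant S \<preceq> (\<Prod>j<card S. b j) ^ 2"
  using assms(1,4)
proof (induction "card S" arbitrary: S)
  case 0
  then show ?case by (simp add: discriminant_def)
next
  case (Suc n)
  have card: "card S = Suc n" using Suc.hyps(2) by simp
  have "(\<Sum>y\<in>S. poly (h n) y / (\<Prod>z\<in>S - {y}. y - z)) = 1"
    using lagrange_leading_coeff[OF \<open>finite S\<close>, of "h n"] card h by simp
  \<comment> \<open>Terms that are all below \<open>1\<close> cannot add up to the leading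
    coefficient \<open>1\<close>.\<close>
  moreover have "(\<Sum>y\<in>S. poly (h n) y / (\<Prod>z\<in>S - {y}. y - z)) \<prec> 1"
    if "\<forall>y\<in>S. poly (h n) y / (\<Prod>z\<in>S - {y}. y - z) \<prec> 1"
    using that by (intro vlt_sum) auto
  ultimately have "\<not> (\<forall>y\<in>S. poly (h n) y / (\<Prod>z\<in>S - {y}. y - z) \<prec> 1)" by auto
  then obtain y where y: "y \<in> S" "1 \<preceq> poly (h n) y / (\<Prod>z\<in>S - {y}. y - z)"
    by (auto simp: not_vlt)
  have nz: "(\<Prod>z\<in>S - {y}. y - z) \<noteq> 0" using \<open>finite S\<close> by auto
  from y(2) have "(\<Prod>z\<in>S - {y}. y - z) \<preceq> poly (h n) y"
    using vle_mult_cancel_right[OF nz, of 1 "poly (h n) y / (\<Prod>z\<in>S - {y}. y - z)"] nz by simp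
  also have "poly (h n) y \<preceq> b n" using Suc.prems y by simp
  finally have 1: "(\<Prod>z\<in>S - {y}. y - z) \<preceq> b n" .
  have "(\<Prod>z\<in>S - {y}. z - y) \<preceq> (\<Prod>z\<in>S - {y}. y - z)"
    by (intro vle_prod veq_imp_vle veq_minus_commute)
  also note 1
  finally have 2: "(\<Prod>z\<in>S - {y}. z - y) \<preceq> b n" .
  have "discriminant (S - {y}) \<preceq> (\<Prod>j<card (S - {y}). b j) ^ 2"
    using Suc.hyps(1)[of "S - {y}"] Suc.prems y card by auto
  with 1 2 have "discriminant S \<preceq> (\<Prod>j<n. b j) ^ 2 * (b n * b n)"
    unfolding discriminant_remove[OF \<open>finite S\<close> y(1)] using card y \<open>finite S\<close>
    by (intro vle_mult) auto
  then show ?case by (simp add: card power2_eq_square ac_simps)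
qed

text \<open>Division of \<open>j\<close> by \<open>D\<close> supplies a monic polynomial of each
  degree \<open>j\<close>, namely \<open>T\<close> to the quotient times the variable to the
  remainder. These are used in Fekete's bound.\<close>

lemma discriminant_vle_powers:
  fixes T :: "'k poly"
  assumes "finite S" and T: "Polynomial.degree T = D" "Polynomial.lead_coeff T = 1" "D > 0"
    and "\<And>u. u \<in> S \<Longrightarrow> poly T u \<preceq> t" and "\<And>u. u \<in> S \<Longrightarrow> u \<preceq> a"
  shows "discriminant S \<preceq>
    (t ^ (\<Sum>j<card S. j div D) * a ^ (\<Sum>j<card S. j mod D)) ^ 2"
proof -
  define h where "h = (\<lambda>j. T ^ (j div D) * [:0, 1:] ^ (j mod D))"
  have "T \<noteq> 0" using T by auto
  have deg: "Polynomial.degree (h j) = j" for j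
    using \<open>T \<noteq> 0\<close> T(1) by (simp add: h_def degree_mult_eq degree_power_eq)
  have "Polynomial.lead_coeff (h j) = 1" for j
    using T by (simp add: h_def lead_coeff_mult lead_coeff_power)
  then have lc: "coeff (h j) j = 1" for j using deg[of j] by metis
  have "discriminant S \<preceq> (\<Prod>j<card S. t ^ (j div D) * a ^ (j mod D)) ^ 2"
  proof (rule discriminant_vle[OF \<open>finite S\<close> deg lc])
    show "poly (h j) u \<preceq> t ^ (j div D) * a ^ (j mod D)" if "u \<in> S" for j u
      using assms(5,6)[OF that] by (auto simp: h_def intro!: vle_mult vle_power)
  qed
  also have "(\<Prod>j<card S. t ^ (j div D) * a ^ (j mod D)) =
      t ^ (\<Sum>j<card S. j div D) * a ^ (\<Sum>j<card S. j mod D)"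
    by (simp add: prod.distrib power_sum)
  finally show ?thesis .
qed

end

section \<open>Dynamics of a two-term polynomial\<close>

lemma preperiodic_step: "preperiodic g x \<Longrightarrow> preperiodic g ((g ^^ n) x)"
proof -
  assume x: "preperiodic g x"
  have "range (\<lambda>k. (g ^^ k) ((g ^^ n) x)) \<subseteq> range (\<lambda>k. (g ^^ k) x)"
    by (auto simp: image_iff) (metis comp_apply funpow_add)
  with x show ?thesis unfolding preperiodic_def by (rule rev_finite_subset)
qed

context valuation_ring
begin

lemma exists_vle_min:
  assumes "finite A" "A \<noteq> {}"
  shows "\<exists>x\<in>A. \<forall>y\<in>A. h x \<preceq> h y"
  using assms
proof (induction rule: finite_ne_induct)
  case (insert x A)
  then obtain z where z: "z \<in> A" "\<forall>y\<in>A. h z \<preceq> h y" by auto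
  show ?case
  proof (cases "h x \<preceq> h z")
    case True
    with z show ?thesis by (intro bexI[of _ x]) (auto intro: vle_trans)
  next
    case False
    with z vle_total show ?thesis by (intro bexI[of _ z]) auto
  qed
qed auto

lemma not_preperiodic_if_increasing:
  assumes "\<And>n. (g ^^ n) x \<prec> (g ^^ Suc n) x"
  shows "\<not> preperiodic g x"
proof -
  have less: "(g ^^ m) x \<prec> (g ^^ (m + Suc k)) x" for m k
  proof (induction k)
    case (Suc k)
    then show ?case using assms[of "m + Suc k"] by (auto intro: vlt_trans)
  qed (use assms in auto)
  have "inj (\<lambda>n. (g ^^ n) x)"
  proof (rule linorder_injI)
    fix m n :: nat assume "m < n"
    then obtain k where "n = m + Suc k" using less_iff_Suc_add by auto
    then show "(g ^^ m) x \<noteq> (g ^^ n) x" using less[of m k] by (auto simp: vlt_def)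
  qed
  then show ?thesis
    unfolding preperiodic_def using finite_imageD infinite_UNIV_nat by blast
qed

lemma power_shift_vle:
  assumes "e \<preceq> z"
  shows "(z + e) ^ n - z ^ n \<preceq> z ^ (n - 1) * e"
proof (cases n)
  case (Suc k)
  have "(z + e) ^ i * z ^ (k - i) \<preceq> z ^ k" if "i \<le> k" for i
  proof -
    have "(z + e) ^ i * z ^ (k - i) \<preceq> z ^ i * z ^ (k - i)"
      using assms by (intro vle_mult vle_power vle_add) auto
    with that show ?thesis by (simp add: power_add [symmetric])
  qed
  then have "(\<Sum>i<Suc k. (z + e) ^ i * z ^ (k - i)) \<preceq> z ^ k"
    by (intro vle_sum) auto
  then have "e * (\<Sum>i<Suc k. (z + e) ^ i * z ^ (k - i)) \<preceq> e * z ^ k"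
    by (intro vle_mult) auto
  moreover have "(z + e) ^ Suc k - z ^ Suc k = e * (\<Sum>i<Suc k. (z + e) ^ i * z ^ (k - i))"
    using power_diff_sumr2[of "z + e" "Suc k" z] by (simp add: ac_simps)
  ultimately show ?thesis using Suc by (simp add: mult.commute)
qed simp

text \<open>In the factorisation of a difference of powers, each of the \<open>n\<close> terms of
  the cofactor is close to \<open>z ^ (n - 1)\<close>. Their sum does not cancel because
  \<open>n\<close> is a unit.\<close>

lemma power_shift_veq:
  assumes "e \<prec> z" and "of_nat n \<asymp> 1"
  shows "(z + e) ^ n - z ^ n \<asymp> z ^ (n - 1) * e"
proof (cases "e = 0")
  case False
  have n0: "n \<noteq> 0" using assms(2) by (metis of_nat_0 one_neq_zero veq_zero_iff(2))
  then obtain k where Suc: "n = Suc k" by (cases n) auto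
  have z0: "z \<noteq> 0" using assms(1) vlt_nonzero by blast
  have "(z + e) ^ i * z ^ (k - i) - z ^ k \<prec> z ^ k" if "i \<le> k" for i
  proof (cases i)
    case 0
    with z0 show ?thesis by (auto simp: vlt_def)
  next
    case (Suc j)
    have "((z + e) ^ i - z ^ i) * z ^ (k - i) \<preceq> (z ^ (i - 1) * e) * z ^ (k - i)"
      using assms(1) by (intro vle_mult power_shift_vle) (auto dest: vlt_imp_vle)
    also have "(z ^ (i - 1) * e) * z ^ (k - i) = (z ^ (i - 1) * z ^ (k - i)) * e"
      by (simp add: ac_simps)
    also have "\<dots> \<prec> (z ^ (i - 1) * z ^ (k - i)) * z"
      using assms(1) z0 by (simp add: vlt_mult_cancel_left)
    also have "(z ^ (i - 1) * z ^ (k - i)) * z = z ^ k"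
      using that Suc by (simp add: power_add [symmetric] flip: power_Suc2)
    finally show ?thesis using that by (simp add: left_diff_distrib power_add [symmetric])
  qed
  then have "(\<Sum>i<Suc k. (z + e) ^ i * z ^ (k - i) - z ^ k) \<prec> z ^ k"
    using z0 by (intro vlt_sum) auto
  also have "z ^ k \<asymp> of_nat n * z ^ k"
    using veq_mult[OF veq_sym[OF assms(2)] veq_refl] by simp
  finally have "of_nat n * z ^ k + (\<Sum>i<Suc k. (z + e) ^ i * z ^ (k - i) - z ^ k) \<asymp> of_nat n * z ^ k"
    by (rule veq_add)
  also have "\<dots> \<asymp> z ^ k" using veq_mult[OF assms(2) veq_refl] by simp
  finally have "(\<Sum>i<Suc k. (z + e) ^ i * z ^ (k - i)) \<asymp> z ^ k"
    unfolding sum_subtractf by (simp add: Suc del: sum.lessThan_Suc)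
  then have "e * (\<Sum>i<Suc k. (z + e) ^ i * z ^ (k - i)) \<asymp> e * z ^ k"
    by (intro veq_mult) auto
  moreover have "(z + e) ^ Suc k - z ^ Suc k = e * (\<Sum>i<Suc k. (z + e) ^ i * z ^ (k - i))"
    using power_diff_sumr2[of "z + e" "Suc k" z] by (simp add: ac_simps)
  ultimately show ?thesis using Suc by (simp add: mult.commute)
qed simp

end

text \<open>Normal form of \<open>f\<close>: the common Frobenius power is pulled out, leaving
  \<open>b1 x ^ s1 + b2 x ^ (p ^ k * s2)\<close> with \<open>p\<close> the characteristic. Dividing
  the two exponent inequalities by this power gives \<open>s1_lower\<close>, where
  \<open>+ 2\<close> encodes strictness below \<open>s1 - 1\<close>, and
  \<open>s1_less\<close>.\<close>

locale two_term =
  fixes b1 b2 :: "'k :: alg_closed_field" and l k s1 s2 :: nat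
  assumes prime_CHAR: "Factorial_Ring.prime CHAR('k)"
    and b1: "b1 \<in> Fp_bar" "b1 \<noteq> 0" and b2: "b2 \<in> Fp_bar" "b2 \<noteq> 0"
    and k_pos: "k > 0" and s2_ge: "2 \<le> s2" and s1_not_dvd: "\<not> CHAR('k) dvd s1"
    and s1_lower: "CHAR('k) ^ k * (s2 - 1) + 2 \<le> s1" and s1_less: "s1 < CHAR('k) ^ k * s2"
begin

definition "q = CHAR('k) ^ l"
definition "r = CHAR('k) ^ k"
definition "m = r * s2"
definition "d = q * m"

definition G :: "'k poly" where
  "G = Polynomial.monom b1 s1 + Polynomial.monom b2 m"

definition g where "g x = poly G x"
definition f where "f x = g x ^ q"

lemma g_altdef: "g x = b1 * x ^ s1 + b2 * x ^ m"
  by (simp add: g_def G_def poly_monom)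

lemma q_pos: "q \<ge> 1"
  using prime_CHAR by (simp add: q_def prime_gt_0_nat Suc_le_eq)

lemma r_ge: "r \<ge> 2"
proof -
  have "r > 1" unfolding r_def using k_pos prime_CHAR prime_gt_1_nat by (metis one_less_power)
  then show ?thesis by simp
qed

lemma s1_bounds: "r * (s2 - 1) + 2 \<le> s1" "s1 < m" "4 \<le> s1" "2 * r \<le> m" "m + 2 \<le> 2 * (s1 - 1)"
proof -
  show 1: "r * (s2 - 1) + 2 \<le> s1" using s1_lower by (simp add: r_def)
  show "s1 < m" using s1_less by (simp add: r_def m_def)
  obtain t where t: "s2 = t + 2" using s2_ge by (metis add.commute le_Suc_ex)
  have 2: "r * 1 \<le> r * (s2 - 1)" using t by (intro mult_left_mono) auto
  with 1 r_ge show "4 \<le> s1" by linarith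
  show "2 * r \<le> m" using s2_ge by (simp add: m_def)
  \<comment> \<open>Since \<open>r \<le> r * (s2 - 1) \<le> s1 - 2\<close>, this yields
    \<open>m \<le> 2 * (s1 - 2)\<close>, the source of the exponent \<open>2\<close> in the later
    bound on \<open>e * a ^ 2\<close>.\<close>
  have "m = r * (s2 - 1) + r" unfolding m_def using t by simp
  with 1 2 show "m + 2 \<le> 2 * (s1 - 1)" by linarith
qed

lemma m_le_d: "m \<le> d"
  using q_pos by (simp add: d_def)

lemma m_gt: "m > 4"
  using s1_bounds by simp

lemma d_gt: "d > 4"
  using m_gt m_le_d by simp

lemma degree_G: "Polynomial.degree G = m" and lead_coeff_G: "coeff G m = b2"
proof -
  show c: "coeff G m = b2" using s1_bounds by (simp add: G_def)
  have "Polynomial.degree G \<le> m"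
    unfolding G_def using s1_bounds by (intro degree_add_le) (auto intro: order.trans[OF degree_monom_le])
  moreover have "m \<le> Polynomial.degree G" using b2 c by (intro le_degree) auto
  ultimately show "Polynomial.degree G = m" by simp
qed

text \<open>The exponent \<open>m\<close> is divisible by the characteristic, so only the first term
  survives.\<close>

lemma pderiv_G: "pderiv G = Polynomial.monom (of_nat s1 * b1) (s1 - 1)"
proof -
  have "of_nat r = (0 :: 'k)" using k_pos by (simp add: r_def)
  then show ?thesis by (simp add: G_def pderiv_add pderiv_monom m_def)
qed

end

section \<open>Escape to infinity and the size of preperiodic points\<close>

locale two_term_valuation = two_term b1 b2 l k s1 s2 + valuation_ring V
  for b1 b2 :: "'k :: alg_closed_field" and l k s1 s2 and V :: "'k set"
begin

lemma b1_unit: "b1 \<asymp> 1" and b2_unit: "b2 \<asymp> 1" and s1_unit: "of_nat s1 \<asymp> 1"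
proof -
  show "b1 \<asymp> 1" "b2 \<asymp> 1" using b1 b2 Fp_bar_veq_one[OF prime_CHAR] by auto
  have "(of_nat s1 :: 'k) \<in> Fp_bar" by (intro Ints_subset_Fp_bar) auto
  moreover have "(of_nat s1 :: 'k) \<noteq> 0" using s1_not_dvd by (simp add: of_nat_eq_0_iff_char_dvd)
  ultimately show "of_nat s1 \<asymp> 1" using Fp_bar_veq_one[OF prime_CHAR] by blast
qed

lemma g_veq: "1 \<prec> x \<Longrightarrow> g x \<asymp> x ^ m"
proof -
  assume x: "1 \<prec> x"
  have 1: "b1 * x ^ s1 \<asymp> x ^ s1" "b2 * x ^ m \<asymp> x ^ m"
    using veq_mult[OF b1_unit veq_refl] veq_mult[OF b2_unit veq_refl] by auto
  note 1(1)
  also have "x ^ s1 \<prec> x ^ m" using x s1_bounds by (intro vlt_power_mono) auto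
  also have "x ^ m \<asymp> b2 * x ^ m" using 1(2) by (rule veq_sym)
  finally have "b2 * x ^ m + b1 * x ^ s1 \<asymp> b2 * x ^ m" by (rule veq_add)
  also note 1(2)
  finally show ?thesis by (simp add: g_altdef add.commute)
qed

lemma g_vle_one: "x \<preceq> 1 \<Longrightarrow> g x \<preceq> 1"
  unfolding g_altdef using vle_mult[OF veq_imp_vle[OF b1_unit] vle_power[of x 1 s1]]
    vle_mult[OF veq_imp_vle[OF b2_unit] vle_power[of x 1 m]] by (auto intro: vle_add)

lemma f_veq: "1 \<prec> x \<Longrightarrow> f x \<asymp> x ^ d"
  unfolding f_def d_def using veq_power[OF g_veq, of x q] by (simp add: power_mult [symmetric] mult.commute)

lemma f_vle_one: "x \<preceq> 1 \<Longrightarrow> f x \<preceq> 1"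
  unfolding f_def using vle_power[OF g_vle_one, of x q] by simp

lemma escape:
  assumes "1 \<prec> x" and "c \<prec> x ^ d"
  shows "f x + c \<asymp> x ^ d"
proof -
  note assms(2)
  also have "x ^ d \<asymp> f x" using f_veq[OF assms(1)] by (rule veq_sym)
  finally have "f x + c \<asymp> f x" by (rule veq_add)
  also note f_veq[OF assms(1)]
  finally show ?thesis .
qed

lemma vlt_power_d: "1 \<prec> x \<Longrightarrow> x \<prec> x ^ d"
  using vlt_power_mono[of x 1 d] d_gt by simp

text \<open>Otherwise the top term dominates at every step and each iteration raises the size to the
  \<open>d\<close>-th power, so the orbit never repeats.\<close>

lemma preperiodic_bound:
  assumes "preperiodic (\<lambda>x. f x + c) x"
  shows "x \<preceq> 1 \<or> x ^ d \<preceq> c"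
proof (rule ccontr)
  assume "\<not> (x \<preceq> 1 \<or> x ^ d \<preceq> c)"
  then have x: "1 \<prec> x \<and> c \<prec> x ^ d" by (auto simp: not_vle)
  define \<phi> where "\<phi> = (\<lambda>x. f x + c)"
  have step: "1 \<prec> \<phi> y \<and> c \<prec> \<phi> y ^ d \<and> y \<prec> \<phi> y" if "1 \<prec> y \<and> c \<prec> y ^ d" for y
  proof -
    have "y \<prec> y ^ d" using that vlt_power_d by blast
    also have eq: "y ^ d \<asymp> \<phi> y" using escape that veq_sym by (auto simp: \<phi>_def)
    finally have 1: "y \<prec> \<phi> y" .
    with that have 2: "1 \<prec> \<phi> y" using vlt_trans by blast
    from that have "c \<prec> y ^ d" by simp
    also note eq
    also have "\<phi> y \<prec> \<phi> y ^ d" using 2 by (rule vlt_power_d)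
    finally show ?thesis using 1 2 by simp
  qed
  have "1 \<prec> (\<phi> ^^ n) x \<and> c \<prec> (\<phi> ^^ n) x ^ d" for n
    by (induction n) (use x step in auto)
  with step have "(\<phi> ^^ n) x \<prec> (\<phi> ^^ Suc n) x" for n by auto
  then have "\<not> preperiodic \<phi> x" by (rule not_preperiodic_if_increasing)
  with assms show False by (simp add: \<phi>_def)
qed

text \<open>Two points preperiodic for the same \<open>c\<close> thus have the same poles. If
  \<open>c\<close> is a pole and \<open>x\<close> is not, the first iterate has the size of
  \<open>c\<close> and escapes.\<close>

lemma preperiodic_integral_iff:
  assumes "preperiodic (\<lambda>x. f x + c) x"
  shows "x \<preceq> 1 \<longleftrightarrow> c \<preceq> 1"
proof
  assume x: "x \<preceq> 1"
  show "c \<preceq> 1"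
  proof (rule ccontr)
    assume "\<not> c \<preceq> 1"
    then have c: "1 \<prec> c" by (simp add: not_vle)
    have "f x \<prec> c" using f_vle_one[OF x] c vle_vlt_trans by blast
    then have y: "f x + c \<asymp> c" using veq_add[of "f x" c] by (simp add: add.commute)
    have "preperiodic (\<lambda>x. f x + c) (f x + c)" using preperiodic_step[OF assms, of 1] by simp
    then have "f x + c \<preceq> 1 \<or> (f x + c) ^ d \<preceq> c" by (rule preperiodic_bound)
    then have "c \<preceq> 1 \<or> c ^ d \<preceq> c"
      using y veq_vle_trans[OF veq_sym[OF y]] veq_vle_trans[OF veq_sym[OF veq_power[OF y]]] by blast
    with c vlt_power_d[OF c] show False by (auto simp: vlt_def)
  qed
next
  assume c: "c \<preceq> 1"
  show "x \<preceq> 1"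
  proof (rule ccontr)
    assume *: "\<not> x \<preceq> 1"
    with preperiodic_bound[OF assms] have "x ^ d \<preceq> c" by simp
    also note c
    finally have "x ^ d \<preceq> 1 ^ d" by simp
    then have "x \<preceq> 1" by (rule vle_power_cancel) (use d_gt in simp)
    with * show False by simp
  qed
qed

text \<open>A larger \<open>c\<close> would dominate the first iterate, which would then escape; a
  smaller one would let \<open>x\<close> itself escape.\<close>

lemma preperiodic_parameter_veq:
  assumes "preperiodic (\<lambda>x. f x + c) x" and x: "1 \<prec> x"
  shows "c \<asymp> x ^ d"
proof -
  have "x ^ d \<preceq> c" using preperiodic_bound[OF assms(1)] x by (auto simp: vlt_def)
  moreover have "c \<preceq> x ^ d"
  proof (rule ccontr)
    assume "\<not> c \<preceq> x ^ d"
    then have c: "x ^ d \<prec> c" by (simp add: not_vle)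
    have "f x \<prec> c" using f_veq[OF x] c by (rule veq_vlt_trans)
    then have y: "f x + c \<asymp> c" using veq_add[of "f x" c] by (simp add: add.commute)
    have c1: "1 \<prec> c" using x vlt_power_d[OF x] c vlt_trans by blast
    have "preperiodic (\<lambda>x. f x + c) (f x + c)" using preperiodic_step[OF assms(1), of 1] by simp
    then have "f x + c \<preceq> 1 \<or> (f x + c) ^ d \<preceq> c" by (rule preperiodic_bound)
    then have "c \<preceq> 1 \<or> c ^ d \<preceq> c"
      using y veq_vle_trans[OF veq_sym[OF y]] veq_vle_trans[OF veq_sym[OF veq_power[OF y]]] by blast
    with c1 vlt_power_d[OF c1] show False by (auto simp: vlt_def)
  qed
  ultimately show ?thesis by (simp add: veq_def)
qed

lemma preperiodic_orbit_vle:
  assumes "preperiodic (\<lambda>x. f x + c) x" and x: "1 \<prec> x"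
  shows "((\<lambda>x. f x + c) ^^ n) x \<preceq> x"
proof -
  let ?y = "((\<lambda>x. f x + c) ^^ n) x"
  have "preperiodic (\<lambda>x. f x + c) ?y" using assms(1) by (rule preperiodic_step)
  then have "?y \<preceq> 1 \<or> ?y ^ d \<preceq> c" by (rule preperiodic_bound)
  moreover have "?y \<preceq> x" if "?y \<preceq> 1" using that x vle_trans vlt_imp_vle by blast
  moreover have "?y \<preceq> x" if "?y ^ d \<preceq> c"
  proof -
    have "?y ^ d \<preceq> x ^ d" using that preperiodic_parameter_veq[OF assms] by (rule vle_veq_trans)
    then show ?thesis by (rule vle_power_cancel) (use d_gt in simp)
  qed
  ultimately show ?thesis by blast
qed

end

section \<open>The fibre of a pole\<close>

lemma poly_pderiv_linear_mult: "poly (pderiv ([:- z, 1:] * Q)) z = poly Q (z :: 'k :: field)"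
  unfolding pderiv_mult by (simp add: pderiv_pCons)

locale two_term_pole = two_term_valuation b1 b2 l k s1 s2 V
  for b1 b2 :: "'k :: alg_closed_field" and l k s1 s2 and V :: "'k set" +
  fixes a :: 'k
  assumes a: "1 \<prec> a"
begin

lemma a_nonzero: "a \<noteq> 0"
  using a vlt_nonzero by blast

lemma a_power_vle: "i \<le> j \<Longrightarrow> a ^ i \<preceq> a ^ j"
  using a by (intro vle_power_mono vlt_imp_vle)

lemma a_power_vlt: "i < j \<Longrightarrow> a ^ i \<prec> a ^ j"
  using a by (intro vlt_power_mono)

lemma vle_a_power: "x \<preceq> a \<Longrightarrow> 0 < n \<Longrightarrow> x \<preceq> a ^ n"
  using a_power_vle[of 1 n] vle_trans by simp

text \<open>The first term changes by the stated amount because \<open>s1\<close> is a unit. The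
  second changes by an \<open>r\<close>-th power of size at most
  \<open>a ^ (r * (s2 - 1)) * e ^ r\<close>, which is smaller since \<open>e ^ (r - 1)\<close> is
  below \<open>a\<close> and \<open>r * (s2 - 1) + 1 \<le> s1 - 1\<close>.\<close>

lemma g_shift_veq:
  assumes z: "z \<asymp> a" and e: "e ^ (r - 1) \<prec> a"
  shows "g (z + e) - g z \<asymp> a ^ (s1 - 1) * e"
proof (cases "e = 0")
  case False
  have "e \<prec> a"
  proof (rule ccontr)
    assume "\<not> e \<prec> a"
    then have "a ^ (r - 1) \<preceq> e ^ (r - 1)" by (intro vle_power) (simp add: not_vlt)
    also note e
    also have "a \<preceq> a ^ (r - 1)" using a_power_vle[of 1 "r - 1"] r_ge by simp
    finally show False by simp
  qed
  also have "a \<asymp> z" using z by (rule veq_sym)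
  finally have ez: "e \<prec> z" .
  have "b1 * ((z + e) ^ s1 - z ^ s1) \<asymp> 1 * (z ^ (s1 - 1) * e)"
    by (intro veq_mult b1_unit power_shift_veq s1_unit ez)
  also have "1 * (z ^ (s1 - 1) * e) \<asymp> 1 * (a ^ (s1 - 1) * e)"
    by (intro veq_mult veq_power z) auto
  finally have 1: "b1 * ((z + e) ^ s1 - z ^ s1) \<asymp> a ^ (s1 - 1) * e" by simp
  have "(z + e) ^ s2 - z ^ s2 \<preceq> z ^ (s2 - 1) * e"
    using ez by (intro power_shift_vle vlt_imp_vle)
  also have "z ^ (s2 - 1) * e \<preceq> a ^ (s2 - 1) * e"
    by (intro vle_mult vle_power veq_imp_vle z) auto
  finally have "((z + e) ^ s2 - z ^ s2) ^ r \<preceq> (a ^ (s2 - 1) * e) ^ r" by (rule vle_power)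
  also have "(a ^ (s2 - 1) * e) ^ r = (a ^ (r * (s2 - 1)) * e) * e ^ (r - 1)"
  proof -
    have "e ^ r = e * e ^ (r - 1)" using r_ge by (metis power_eq_if not_numeral_le_zero)
    then show ?thesis by (simp add: power_mult_distrib power_mult [symmetric] ac_simps)
  qed
  also have "\<dots> \<prec> (a ^ (r * (s2 - 1)) * e) * a"
    using a_nonzero False e by (simp add: vlt_mult_cancel_left)
  also have "\<dots> = a ^ (r * (s2 - 1) + 1) * e" by simp
  also have "\<dots> \<preceq> a ^ (s1 - 1) * e"
    using s1_bounds by (intro vle_mult a_power_vle) auto
  finally have 2: "((z + e) ^ s2 - z ^ s2) ^ r \<prec> a ^ (s1 - 1) * e" .
  have frob: "(z + e) ^ m - z ^ m = ((z + e) ^ s2 - z ^ s2) ^ r"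
  proof -
    have "(((z + e) ^ s2 - z ^ s2) + z ^ s2) ^ r = ((z + e) ^ s2 - z ^ s2) ^ r + (z ^ s2) ^ r"
      using prime_CHAR by (rule freshmans_dream') (simp add: r_def)
    then show ?thesis by (simp add: m_def power_mult [symmetric] mult.commute)
  qed
  have "b2 * ((z + e) ^ m - z ^ m) \<preceq> 1 * ((z + e) ^ s2 - z ^ s2) ^ r"
    unfolding frob by (intro vle_mult veq_imp_vle b2_unit) auto
  with 2 have "b2 * ((z + e) ^ m - z ^ m) \<prec> a ^ (s1 - 1) * e" using vle_vlt_trans by simp
  also note veq_sym[OF 1]
  finally have "b1 * ((z + e) ^ s1 - z ^ s1) + b2 * ((z + e) ^ m - z ^ m) \<asymp> b1 * ((z + e) ^ s1 - z ^ s1)"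
    by (rule veq_add)
  also note 1
  finally show ?thesis by (simp add: g_altdef algebra_simps)
qed simp

definition Z where "Z = {z. g z = g a}"

lemma Z_veq: "z \<in> Z \<Longrightarrow> z \<asymp> a"
proof -
  assume "z \<in> Z"
  then have z: "g z = g a" by (simp add: Z_def)
  have "1 \<prec> z"
  proof (rule ccontr)
    assume "\<not> 1 \<prec> z"
    then have "g z \<preceq> 1" by (intro g_vle_one) (simp add: not_vlt)
    with z have "g a \<preceq> 1" by simp
    moreover have "1 \<prec> a ^ m" using a m_gt by (intro one_vlt_power) auto
    ultimately show False using g_veq[OF a] vle_vlt_trans veq_vle_trans veq_sym vlt_irrefl by metis
  qed
  then have "z ^ m \<asymp> a ^ m" using g_veq a z veq_trans veq_sym by metis
  then show ?thesis by (rule veq_power_cancel) (use m_gt in simp)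
qed

definition P where "P = G - [:g a:]"

lemma poly_P: "poly P x = g x - g a"
  by (simp add: P_def g_def)

lemma degree_P: "Polynomial.degree P = m" and lead_coeff_P: "coeff P m = b2"
proof -
  show c: "coeff P m = b2"
    using m_gt lead_coeff_G by (simp add: P_def coeff_pCons split: nat.splits)
  have "Polynomial.degree P \<le> m" unfolding P_def using degree_G
    by (intro degree_diff_le) auto
  moreover have "m \<le> Polynomial.degree P" using b2 c by (intro le_degree) auto
  ultimately show "Polynomial.degree P = m" by simp
qed

lemma pderiv_P_veq: "z \<in> Z \<Longrightarrow> poly (pderiv P) z \<asymp> a ^ (s1 - 1)"
proof -
  assume z: "z \<in> Z"
  have "poly (pderiv P) z = of_nat s1 * b1 * z ^ (s1 - 1)"
    by (simp add: P_def pderiv_diff pderiv_G pderiv_pCons poly_monom)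
  also have "\<dots> \<asymp> 1 * 1 * a ^ (s1 - 1)"
    by (intro veq_mult s1_unit b1_unit veq_power Z_veq z)
  finally show ?thesis by simp
qed

text \<open>A repeated root would be a zero of the derivative, whose size at a point of
  \<open>Z\<close> is \<open>a ^ (s1 - 1)\<close>. So the multiset of roots is the set
  \<open>Z\<close>.\<close>

lemma finite_Z: "finite Z" and card_Z: "card Z = m"
  and P_eq_prod: "P = smult b2 (\<Prod>z\<in>Z. [:- z, 1:])"
proof -
  have P0: "P \<noteq> 0" using degree_P m_gt by auto
  obtain A where A: "size A = Polynomial.degree P"
    "P = smult (Polynomial.lead_coeff P) (\<Prod>x\<in>#A. [:- x, 1:])"
    using alg_closed_imp_factorization[OF P0] by blast
  have Z: "Z = {z. poly P z = 0}" by (simp add: Z_def poly_P)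
  then show fin: "finite Z" using poly_roots_finite[OF P0] by simp
  have A': "P = smult b2 (\<Prod>x\<in>#A. [:- x, 1:])" using A(2) lead_coeff_P degree_P by simp
  have "poly P z = b2 * (\<Prod>x\<in>#A. z - x)" for z
    unfolding A' by (simp add: poly_prod_mset)
  then have set_A: "set_mset A = Z" using b2 by (auto simp: Z prod_mset_zero_iff)
  have "count A z \<le> 1" for z
  proof (rule ccontr)
    assume "\<not> count A z \<le> 1"
    then have "count {#z, z#} x \<le> count A x" for x by auto
    then have "{#z, z#} \<subseteq># A" by (intro mset_subset_eqI)
    then obtain B where B: "A = {#z, z#} + B" using mset_subset_eq_exists_conv by blast
    then have "P = [:- z, 1:] * ([:- z, 1:] * smult b2 (\<Prod>x\<in>#B. [:- x, 1:]))"
      unfolding A' by simp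
    then have "poly (pderiv P) z = 0" by (simp only: poly_pderiv_linear_mult) simp
    moreover have "z \<in> Z" using B set_A by auto
    ultimately have "0 \<asymp> a ^ (s1 - 1)" using pderiv_P_veq by metis
    then show False using a_nonzero by simp
  qed
  then have "count A z = count (mset_set Z) z" for z
    using set_A fin by (cases "z \<in> Z") (auto simp: count_mset_set le_Suc_eq not_in_iff [symmetric]
        simp flip: count_greater_eq_one_iff intro: antisym)
  then have A_eq: "A = mset_set Z" by (intro multiset_eqI)
  show "card Z = m" using A(1) degree_P by (simp add: A_eq)
  show "P = smult b2 (\<Prod>z\<in>Z. [:- z, 1:])" using A' by (simp add: A_eq prod_unfold_prod_mset)
qed

text \<open>Up to the unit \<open>b2\<close> this product is the derivative of \<open>P\<close> at
  \<open>z\<close>.\<close>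

lemma Z_prod_veq: "z \<in> Z \<Longrightarrow> (\<Prod>y\<in>Z - {z}. z - y) \<asymp> a ^ (s1 - 1)"
proof -
  assume z: "z \<in> Z"
  have "P = [:- z, 1:] * smult b2 (\<Prod>y\<in>Z - {z}. [:- y, 1:])"
    unfolding P_eq_prod using finite_Z z by (simp add: prod.remove)
  then have "poly (pderiv P) z = b2 * (\<Prod>y\<in>Z - {z}. z - y)"
    by (simp only: poly_pderiv_linear_mult) (simp add: poly_prod)
  moreover have "b2 * (\<Prod>y\<in>Z - {z}. z - y) \<asymp> 1 * (\<Prod>y\<in>Z - {z}. z - y)"
    by (intro veq_mult b2_unit) auto
  ultimately show ?thesis using pderiv_P_veq[OF z] veq_trans veq_sym by (metis mult_1)
qed

text \<open>For closer points \<open>g_shift_veq\<close> would give \<open>g z - g y\<close> a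
  nonzero size.\<close>

lemma Z_separated:
  assumes "z \<in> Z" "y \<in> Z" "z \<noteq> y"
  shows "a \<preceq> (z - y) ^ (r - 1)"
proof (rule ccontr)
  assume "\<not> a \<preceq> (z - y) ^ (r - 1)"
  then have "g (y + (z - y)) - g y \<asymp> a ^ (s1 - 1) * (z - y)"
    using assms by (intro g_shift_veq Z_veq) (auto simp: not_vle)
  with assms show False using a_nonzero by (simp add: Z_def)
qed

lemma Z_distance: "z \<in> Z \<Longrightarrow> y \<in> Z \<Longrightarrow> z \<noteq> y \<Longrightarrow> 1 \<prec> z - y"
proof -
  assume zy: "z \<in> Z" "y \<in> Z" "z \<noteq> y"
  have "1 ^ (r - 1) \<prec> (z - y) ^ (r - 1)" using vlt_vle_trans[OF a Z_separated[OF zy]] by simp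
  then show ?thesis by (rule vlt_power_cancel)
qed

text \<open>The radius is \<open>a\<close> divided by \<open>a ^ (s1 - 1)\<close>, that is, the
  allowed error in \<open>g\<close> divided by the size of its derivative at the roots.\<close>

definition near where "near u z \<longleftrightarrow> (u - z) * a ^ (s1 - 2) \<preceq> 1"

lemma near_vle: "near u z \<Longrightarrow> u - z \<preceq> 1"
proof -
  assume "near u z"
  have "(u - z) * 1 \<preceq> (u - z) * a ^ (s1 - 2)"
    using a_power_vle[of 0 "s1 - 2"] by (intro vle_mult) auto
  also have "\<dots> \<preceq> 1" using \<open>near u z\<close> by (simp add: near_def)
  finally show ?thesis by simp
qed

lemma Z_distance_shift:
  assumes "z \<in> Z" "y \<in> Z" "z \<noteq> y" "v - z \<preceq> 1"
  shows "v - y \<asymp> z - y"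
  using veq_add[OF vle_vlt_trans[OF assms(4) Z_distance[OF assms(1-3)]]] by (simp add: algebra_simps)

text \<open>Take the root \<open>z\<close> closest to \<open>u\<close>. Every other root
  \<open>y\<close> is at least as far from \<open>u\<close> as from \<open>z\<close>, so the
  remaining factors of \<open>P\<close> have product at least \<open>a ^ (s1 - 1)\<close>, and
  \<open>u - z\<close> carries the rest.\<close>

lemma exists_near:
  assumes "g u - g a \<preceq> a"
  shows "\<exists>z\<in>Z. near u z"
proof -
  have "Z \<noteq> {}" using card_Z m_gt by auto
  then obtain z where z: "z \<in> Z" "\<And>y. y \<in> Z \<Longrightarrow> u - z \<preceq> u - y"
    using exists_vle_min[OF finite_Z, of "\<lambda>z. u - z"] by blast
  have "z - y \<preceq> u - y" if "y \<in> Z" for y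
    using vle_diff[OF vle_refl z(2)[OF that]] by simp
  then have "(\<Prod>y\<in>Z - {z}. z - y) \<preceq> (\<Prod>y\<in>Z - {z}. u - y)" by (intro vle_prod) auto
  with Z_prod_veq[OF z(1)] have "a ^ (s1 - 1) \<preceq> (\<Prod>y\<in>Z - {z}. u - y)"
    using veq_vle_trans veq_sym by blast
  then have "(u - z) * a ^ (s1 - 1) \<preceq> (u - z) * (\<Prod>y\<in>Z - {z}. u - y)"
    by (intro vle_mult) auto
  also have "(u - z) * (\<Prod>y\<in>Z - {z}. u - y) = (\<Prod>y\<in>Z. u - y)"
    using finite_Z z(1) by (simp add: prod.remove)
  also have "\<dots> \<asymp> b2 * (\<Prod>y\<in>Z. u - y)" using veq_mult[OF veq_sym[OF b2_unit] veq_refl] by simp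
  also have "b2 * (\<Prod>y\<in>Z. u - y) = g u - g a"
    unfolding poly_P [symmetric] P_eq_prod by (simp add: poly_prod)
  also note assms
  finally have "(u - z) * a ^ (s1 - 1) \<preceq> a" .
  moreover have "s1 - 1 = Suc (s1 - 2)" using s1_bounds by simp
  ultimately have "((u - z) * a ^ (s1 - 2)) * a \<preceq> 1 * a" by (simp add: ac_simps)
  then have "(u - z) * a ^ (s1 - 2) \<preceq> 1" using vle_mult_cancel_right[OF a_nonzero, of _ 1] by blast
  then show ?thesis using z(1) by (auto simp: near_def)
qed

text \<open>By additivity of Frobenius \<open>f u - f a\<close> is the \<open>q\<close>-th power of
  \<open>g u - g a\<close>; the bound \<open>a\<close> is relaxed to \<open>a ^ q\<close> before
  taking roots.\<close>

lemma exists_near_f: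
  assumes "f u - f a \<preceq> a"
  shows "\<exists>z\<in>Z. near u z"
proof (rule exists_near)
  have "((g u - g a) + g a) ^ q = (g u - g a) ^ q + g a ^ q"
    using prime_CHAR by (rule freshmans_dream') (simp add: q_def)
  with assms have "(g u - g a) ^ q \<preceq> a" by (simp add: f_def)
  also have "a \<preceq> a ^ q" using a_power_vle[of 1 q] q_pos by simp
  finally show "g u - g a \<preceq> a" by (rule vle_power_cancel) (use q_pos in simp)
qed

end

section \<open>The difference of the inner polynomial and its translate\<close>

lemma coeff_power_difference:
  fixes c :: "'k :: field"
  shows "Polynomial.degree ([:0, 1:] ^ n - [:- c, 1:] ^ n) \<le> n - 1" (is "Polynomial.degree ?D \<le> _")
    and "coeff ([:0, 1:] ^ n - [:- c, 1:] ^ n) (n - 1) = of_nat n * c"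
proof -
  have D: "?D = smult c (\<Sum>i<n. [:- c, 1:] ^ (n - Suc i) * [:0, 1:] ^ i)"
    using power_diff_sumr2[of "[:0, 1:] :: 'k poly" n "[:- c, 1:]"] by simp
  have t: "Polynomial.degree ([:- c, 1:] ^ (n - Suc i) * [:0, 1:] ^ i) = n - 1"
      "coeff ([:- c, 1:] ^ (n - Suc i) * [:0, 1:] ^ i) (n - 1) = 1" if "i < n" for i
  proof -
    show deg: "Polynomial.degree ([:- c, 1:] ^ (n - Suc i) * [:0, 1:] ^ i) = n - 1"
      using that by (subst degree_mult_eq) (auto simp: degree_power_eq)
    have "Polynomial.lead_coeff ([:- c, 1:] ^ (n - Suc i) * [:0, 1:] ^ i) = 1"
      by (simp only: lead_coeff_mult lead_coeff_power) simp
    then show "coeff ([:- c, 1:] ^ (n - Suc i) * [:0, 1:] ^ i) (n - 1) = 1" unfolding deg .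
  qed
  show "Polynomial.degree ?D \<le> n - 1"
    unfolding D by (intro order.trans[OF degree_smult_le] degree_sum_le) (use t in auto)
  have "(\<Sum>i<n. coeff ([:- c, 1:] ^ (n - Suc i) * [:0, 1:] ^ i) (n - 1)) = (\<Sum>i<n. 1)"
    by (intro sum.cong refl t) simp
  then show "coeff ?D (n - 1) = of_nat n * c"
    unfolding D by (simp add: coeff_sum mult.commute)
qed

context two_term
begin

text \<open>The second summand is kept as an \<open>r\<close>-th power: this shows that its degree
  is at most \<open>r * (s2 - 1)\<close>, since the top terms cancel inside the power.\<close>

definition shift_difference :: "'k \<Rightarrow> 'k poly" where
  "shift_difference e = smult b1 ([:0, 1:] ^ s1 - [:- e, 1:] ^ s1) +
     smult b2 (([:0, 1:] ^ s2 - [:- e, 1:] ^ s2) ^ r)"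

lemma poly_shift_difference: "poly (shift_difference e) u = g u - g (u - e)"
proof -
  have "((u ^ s2 - (u - e) ^ s2) + (u - e) ^ s2) ^ r = (u ^ s2 - (u - e) ^ s2) ^ r + ((u - e) ^ s2) ^ r"
    using prime_CHAR by (rule freshmans_dream') (simp add: r_def)
  then have "(u ^ s2 - (u - e) ^ s2) ^ r = u ^ m - (u - e) ^ m"
    by (simp add: m_def power_mult [symmetric] mult.commute)
  moreover have "poly (shift_difference e) u =
      b1 * (u ^ s1 - (u - e) ^ s1) + b2 * (u ^ s2 - (u - e) ^ s2) ^ r"
    by (simp add: shift_difference_def)
  ultimately show ?thesis by (simp only: g_altdef) (simp add: algebra_simps)
qed

text \<open>The inequality on the exponents puts the degree of the second summand below
  \<open>s1 - 1\<close>, so the first summand alone gives the leading coefficient.\<close>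

lemma degree_shift_difference: "Polynomial.degree (shift_difference e) \<le> s1 - 1"
  and coeff_shift_difference: "coeff (shift_difference e) (s1 - 1) = of_nat s1 * b1 * e"
proof -
  have "Polynomial.degree (([:0, 1:] ^ s2 - [:- e, 1:] ^ s2) ^ r) \<le> r * (s2 - 1)"
    using order.trans[OF degree_power_le mult_right_mono[OF coeff_power_difference(1)]]
    by (metis mult.commute zero_le)
  also have "\<dots> < s1 - 1" using s1_bounds by simp
  finally have *: "Polynomial.degree (([:0, 1:] ^ s2 - [:- e, 1:] ^ s2) ^ r) < s1 - 1" .
  show "Polynomial.degree (shift_difference e) \<le> s1 - 1"
    unfolding shift_difference_def using *
    by (intro degree_add_le order.trans[OF degree_smult_le] coeff_power_difference(1)) auto
  show "coeff (shift_difference e) (s1 - 1) = of_nat s1 * b1 * e"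
    unfolding shift_difference_def coeff_add coeff_smult coeff_power_difference(2)
    using coeff_eq_0[OF *] by simp
qed

end

context two_term_pole
begin

text \<open>
  Interpolating \<open>g u - g (u - e)\<close> at one point near each root of \<open>g u = g a\<close> recovers its leading
  coefficient, of the size of \<open>e\<close>.
\<close>
lemma shift_small_if_all_roots_hit:
  assumes near: "\<And>z. z \<in> Z \<Longrightarrow> near (y z) z"
    and y_vle: "\<And>z. z \<in> Z \<Longrightarrow> y z \<preceq> a"
    and diff: "\<And>z. z \<in> Z \<Longrightarrow> g (y z) - g (y z - e) \<preceq> a"
  shows "e * a ^ 2 \<preceq> 1"
proof -
  have dist: "y z - y z' \<asymp> z - z'" if z: "z \<in> Z" "z' \<in> Z" "z \<noteq> z'" for z z'
  proof -
    have 1: "y z - z' \<asymp> z - z'"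
      using Z_distance_shift z near_vle near by blast
    have "y z' - z' \<preceq> 1" using near z near_vle by blast
    also have "1 \<prec> z - z'" using Z_distance z by blast
    also have "z - z' \<asymp> y z - z'" using 1 by (rule veq_sym)
    finally have "(y z - z') - (y z' - z') \<asymp> y z - z'" by (rule veq_diff)
    also note 1
    finally show ?thesis by simp
  qed
  have inj: "inj_on y Z"
  proof (rule inj_onI, rule ccontr)
    fix z z' assume z: "z \<in> Z" "z' \<in> Z" "y z = y z'" "z \<noteq> z'"
    then show False using dist[OF z(1,2,4)] by simp
  qed
  \<comment> \<open>The monomial factor raises the degree bound to
    \<open>m - 1 = card Z - 1\<close>, the degree whose coefficient Lagrange's formula reads
    off.\<close>
  define H where "H = Polynomial.monom 1 (m - s1) * shift_difference e"
  have "Polynomial.degree H \<le> (m - s1) + (s1 - 1)"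
    unfolding H_def using degree_shift_difference[of e] degree_monom_le[of "1::'k" "m - s1"]
    by (intro order.trans[OF degree_mult_le]) simp
  also have "\<dots> < card (y ` Z)" using s1_bounds card_Z inj by (simp add: card_image)
  finally have deg: "Polynomial.degree H < card (y ` Z)" .
  have "coeff H (m - 1) = coeff (shift_difference e) (s1 - 1)"
    using s1_bounds by (simp add: H_def coeff_monom_mult)
  then have "of_nat s1 * b1 * e = coeff H (card (y ` Z) - 1)"
    using card_Z inj by (simp add: card_image coeff_shift_difference del: One_nat_def)
  also have "\<dots> = (\<Sum>u\<in>y ` Z. poly H u / (\<Prod>v\<in>y ` Z - {u}. u - v))"
    using lagrange_leading_coeff[OF finite_imageI[OF finite_Z] deg] by simp
  finally have e_eq: "of_nat s1 * b1 * e * a ^ (s1 - 1) =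
      (\<Sum>u\<in>y ` Z. poly H u / (\<Prod>v\<in>y ` Z - {u}. u - v) * a ^ (s1 - 1))"
    by (simp add: sum_distrib_right)
  have term_vle: "poly H u / (\<Prod>v\<in>y ` Z - {u}. u - v) * a ^ (s1 - 1) \<preceq> a ^ (m - s1 + 1)"
    if u: "u \<in> y ` Z" for u
  proof -
    from u obtain z where z: "z \<in> Z" "u = y z" by auto
    have "y ` Z - {u} = y ` (Z - {z})" using inj z by (auto simp: inj_on_def)
    moreover have "inj_on y (Z - {z})" using inj by (rule inj_on_diff)
    ultimately have "(\<Prod>v\<in>y ` Z - {u}. u - v) = (\<Prod>z'\<in>Z - {z}. y z - y z')"
      by (simp add: prod.reindex z)
    also have "\<dots> \<asymp> (\<Prod>z'\<in>Z - {z}. z - z')" using z by (intro veq_prod dist) auto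
    also have "\<dots> \<asymp> a ^ (s1 - 1)" using z by (intro Z_prod_veq)
    finally have B: "(\<Prod>v\<in>y ` Z - {u}. u - v) \<asymp> a ^ (s1 - 1)" (is "?B \<asymp> _") .
    then have "?B \<noteq> 0" using a_nonzero by (metis power_not_zero veq_zero_iff(2))
    have "poly H u = u ^ (m - s1) * (g u - g (u - e))"
      by (simp add: H_def poly_monom poly_shift_difference)
    also have "\<dots> \<preceq> a ^ (m - s1) * a"
      using z y_vle diff by (intro vle_mult vle_power) auto
    finally have H: "poly H u \<preceq> a ^ (m - s1) * a" .
    have "poly H u / ?B * a ^ (s1 - 1) \<preceq> poly H u / ?B * ?B"
      by (intro vle_mult veq_imp_vle[OF veq_sym[OF B]]) auto
    also have "\<dots> = poly H u" using \<open>?B \<noteq> 0\<close> by simp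
    also note H
    finally show ?thesis by (simp only: power_add power_one_right)
  qed
  have "e * a ^ (s1 - 1) \<asymp> of_nat s1 * b1 * e * a ^ (s1 - 1)"
    using veq_mult[OF veq_mult[OF s1_unit b1_unit] veq_refl[of "e * a ^ (s1 - 1)"]] veq_sym
    by (simp add: mult.assoc)
  also have "\<dots> \<preceq> a ^ (m - s1 + 1)" unfolding e_eq using term_vle by (rule vle_sum)
  finally have "e * a ^ (s1 - 1) * a ^ (s1 - 1) \<preceq> a ^ (m - s1 + 1) * a ^ (s1 - 1)"
    by (intro vle_mult) auto
  moreover have "m - s1 + 1 + (s1 - 1) = m" "s1 - 1 + (s1 - 1) = 2 * (s1 - 1)" using s1_bounds by auto
  ultimately have 1: "e * a ^ (2 * (s1 - 1)) \<preceq> a ^ m"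
    by (simp only: mult.assoc power_add [symmetric])
  \<comment> \<open>Here \<open>m + 2 \<le> 2 * (s1 - 1)\<close> turns the estimate into a gain of
    \<open>a ^ 2\<close>.\<close>
  have "e * a ^ (m + 2) \<preceq> e * a ^ (2 * (s1 - 1))"
    using s1_bounds by (intro vle_mult a_power_vle) auto
  also note 1
  finally have "(e * a ^ 2) * a ^ m \<preceq> 1 * a ^ m"
    by (simp only: power_add mult.assoc mult_1 mult.commute[of "a ^ m"])
  then show ?thesis using a_nonzero vle_mult_cancel_right[of "a ^ m" _ 1] by simp
qed

text \<open>With \<open>u = f a + c\<close>, so that \<open>c = u - f a\<close>, these are the
  second and third iterates of \<open>a\<close> as polynomials in its first iterate
  \<open>u\<close>.\<close>

definition iter2 :: "'k poly" where "iter2 = G ^ q + [:- f a, 1:]"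
definition iter3 :: "'k poly" where "iter3 = pcompose (G ^ q) iter2 + [:- f a, 1:]"

lemma poly_iter2: "poly iter2 u = f u + (u - f a)"
  by (simp add: iter2_def f_def g_def)

lemma poly_iter3: "poly iter3 u = f (poly iter2 u) + (u - f a)"
  by (simp add: iter3_def f_def g_def poly_pcompose)

lemma degree_add_linear:
  fixes Q :: "'k poly"
  assumes "Polynomial.degree Q > 1"
  shows "Polynomial.degree (Q + [:x, y:]) = Polynomial.degree Q"
    and "Polynomial.lead_coeff (Q + [:x, y:]) = Polynomial.lead_coeff Q"
proof -
  have "Polynomial.degree [:x, y:] \<le> 1" by simp
  also note assms
  finally have "Polynomial.degree [:x, y:] < Polynomial.degree Q" .
  then show "Polynomial.degree (Q + [:x, y:]) = Polynomial.degree Q"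
    "Polynomial.lead_coeff (Q + [:x, y:]) = Polynomial.lead_coeff Q"
    by (simp_all add: degree_add_eq_left lead_coeff_add_le add.commute coeff_eq_0)
qed

lemma degree_G_power: "Polynomial.degree (G ^ q) = d" "Polynomial.lead_coeff (G ^ q) = b2 ^ q"
proof -
  have "G \<noteq> 0" using degree_G m_gt by auto
  then show "Polynomial.degree (G ^ q) = d" "Polynomial.lead_coeff (G ^ q) = b2 ^ q"
    using degree_G lead_coeff_G lead_coeff_power[of G q] by (simp_all add: degree_power_eq d_def)
qed

lemma degree_iter3: "Polynomial.degree iter3 = d ^ 2" and lead_coeff_iter3: "Polynomial.lead_coeff iter3 \<asymp> 1"
proof -
  have iter2: "Polynomial.degree iter2 = d" "Polynomial.lead_coeff iter2 = b2 ^ q"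
    unfolding iter2_def using degree_add_linear[of "G ^ q"] degree_G_power d_gt by auto
  have C: "Polynomial.degree (pcompose (G ^ q) iter2) = d ^ 2"
    "Polynomial.lead_coeff (pcompose (G ^ q) iter2) = b2 ^ q * (b2 ^ q) ^ d"
    using iter2 degree_G_power d_gt lead_coeff_comp[of iter2 "G ^ q"]
    by (simp_all add: degree_pcompose power2_eq_square)
  have "1 < d ^ 2" using d_gt by (intro one_less_power) auto
  then show "Polynomial.degree iter3 = d ^ 2" unfolding iter3_def using degree_add_linear(1) C by simp
  have "Polynomial.lead_coeff iter3 = b2 ^ q * (b2 ^ q) ^ d"
    unfolding iter3_def using degree_add_linear(2) C \<open>1 < d ^ 2\<close> by simp
  moreover have "b2 ^ q * (b2 ^ q) ^ d \<asymp> 1 ^ q * (1 ^ q) ^ d"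
    by (intro veq_mult veq_power b2_unit)
  ultimately show "Polynomial.lead_coeff iter3 \<asymp> 1" by simp
qed

text \<open>If \<open>u\<close> or \<open>iter2\<close> exceeded \<open>a\<close>, the next
  iteration would raise its size to the \<open>d\<close>-th power. So both are at most
  \<open>a\<close>, and \<open>f u - f a\<close> is the difference of \<open>iter2\<close> and
  \<open>u\<close>.\<close>

lemma iter3_small:
  assumes iter3: "poly iter3 u \<preceq> a"
  shows "\<exists>z\<in>Z. near u z"
proof -
  have fa: "f a \<asymp> a ^ d" using a by (rule f_veq)
  have u: "u \<preceq> a"
  proof (rule ccontr)
    assume "\<not> u \<preceq> a"
    then have au: "a \<prec> u" by (simp add: not_vle)
    then have 1: "1 \<prec> u" using a vlt_trans by blast
    have "f a \<prec> u ^ d" using fa au d_gt by (meson veq_vlt_trans vlt_power le_less_trans zero_le)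
    then have rest: "u - f a \<prec> u ^ d" using vlt_power_d[OF 1] by (intro vlt_diff)
    then have iter2: "poly iter2 u \<asymp> u ^ d"
      unfolding poly_iter2 using f_veq[OF 1] veq_add vlt_veq_trans veq_sym veq_trans by meson
    have 2: "1 \<prec> u ^ d" using 1 d_gt by (intro one_vlt_power) auto
    then have "1 \<prec> poly iter2 u" using iter2 vlt_veq_trans veq_sym by blast
    then have iter2': "f (poly iter2 u) \<asymp> (u ^ d) ^ d" using f_veq iter2 veq_power veq_trans by blast
    have "u - f a \<prec> (u ^ d) ^ d" using rest vlt_power_d[OF 2] by (rule vlt_trans)
    then have "poly iter3 u \<asymp> (u ^ d) ^ d"
      unfolding poly_iter3 using iter2' veq_add vlt_veq_trans veq_sym veq_trans by meson
    moreover have "a \<prec> (u ^ d) ^ d"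
      using au vlt_power_d[OF 1] vlt_power_d[OF 2] vlt_trans by blast
    ultimately show False using iter3 by (meson vlt_irrefl vlt_vle_trans vlt_veq_trans veq_sym)
  qed
  have iter2: "poly iter2 u \<preceq> a"
  proof (rule ccontr)
    let ?w = "poly iter2 u"
    assume "\<not> ?w \<preceq> a"
    then have aw: "a \<prec> ?w" by (simp add: not_vle)
    then have 1: "1 \<prec> ?w" using a vlt_trans by blast
    have "f a \<prec> ?w ^ d" using fa aw d_gt by (meson veq_vlt_trans vlt_power le_less_trans zero_le)
    moreover have "u \<prec> ?w ^ d" using u aw vlt_power_d[OF 1] by (meson vle_vlt_trans vlt_trans)
    ultimately have "u - f a \<prec> ?w ^ d" by (intro vlt_diff)
    then have "poly iter3 u \<asymp> ?w ^ d"
      unfolding poly_iter3 using f_veq[OF 1] veq_add vlt_veq_trans veq_sym veq_trans by meson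
    moreover have "a \<prec> ?w ^ d" using aw vlt_power_d[OF 1] vlt_trans by blast
    ultimately show False using iter3 by (meson vlt_irrefl vlt_vle_trans vlt_veq_trans veq_sym)
  qed
  have "f u - f a \<preceq> a" using vle_diff[OF iter2 u] by (simp add: poly_iter2)
  then show ?thesis by (rule exists_near_f)
qed

text \<open>Put \<open>w = a ^ (s1 - 1) * e\<close>. Near a root, \<open>f v - f a\<close> has size
  \<open>w ^ q\<close>; as \<open>w\<close> exceeds \<open>a\<close>, this dominates
  \<open>iter2\<close>, and its \<open>d\<close>-th power dominates \<open>iter3\<close>.\<close>

lemma iter3_near_root:
  assumes z: "z \<in> Z" and e: "e \<preceq> 1" and large: "a \<prec> a ^ (s1 - 1) * e"
  shows "poly iter3 (z + e) - a \<asymp> (a ^ (s1 - 1) * e) ^ (q * d)"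
proof -
  define w where "w = a ^ (s1 - 1) * e"
  define v where "v = z + e"
  have w: "a \<prec> w" "1 \<prec> w" using large a vlt_trans by (auto simp: w_def)
  have "e ^ (r - 1) \<preceq> 1" using vle_power[OF e, of "r - 1"] by simp
  then have "e ^ (r - 1) \<prec> a" using a by (rule vle_vlt_trans)
  then have "g v - g z \<asymp> w"
    unfolding v_def w_def using z by (intro g_shift_veq Z_veq)
  moreover have "f v - f a = (g v - g z) ^ q"
  proof -
    have "((g v - g a) + g a) ^ q = (g v - g a) ^ q + g a ^ q"
      using prime_CHAR by (rule freshmans_dream') (simp add: q_def)
    then show ?thesis using z by (simp add: f_def Z_def)
  qed
  ultimately have fv: "f v - f a \<asymp> w ^ q" using veq_power by simp
  have v: "v \<preceq> a"
    unfolding v_def using Z_veq[OF z] e a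
    by (intro vle_add) (auto intro: veq_imp_vle vle_trans vlt_imp_vle)
  have wq: "w \<preceq> w ^ q" using w q_pos by (intro vle_power_self vlt_imp_vle) auto
  have "v \<prec> w ^ q" using v w(1) wq by (meson vle_vlt_trans vlt_vle_trans)
  then have "(f v - f a) + v \<asymp> f v - f a" using fv veq_sym vlt_veq_trans by (intro veq_add) blast
  then have iter2: "poly iter2 v \<asymp> w ^ q" using fv veq_trans by (simp add: poly_iter2 algebra_simps)
  have 1: "1 \<prec> w ^ q" using w q_pos by (intro one_vlt_power) auto
  then have "1 \<prec> poly iter2 v" using iter2 veq_sym vlt_veq_trans by blast
  then have fiter2: "f (poly iter2 v) \<asymp> (w ^ q) ^ d" using f_veq iter2 veq_power veq_trans by blast
  have "a ^ d \<prec> (w ^ q) ^ d"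
    using w wq d_gt by (intro vlt_power) (auto intro: vlt_vle_trans)
  moreover have "v - f a - a \<preceq> a ^ d"
    using vle_a_power[OF v] vle_a_power[OF vle_refl] veq_imp_vle[OF f_veq[OF a]] d_gt
    by (intro vle_diff) auto
  ultimately have "v - f a - a \<prec> f (poly iter2 v)"
    using fiter2 by (meson vle_vlt_trans vlt_veq_trans veq_sym)
  then have "f (poly iter2 v) + (v - f a - a) \<asymp> f (poly iter2 v)" by (rule veq_add)
  then have "poly iter3 v - a \<asymp> (w ^ q) ^ d" using fiter2 veq_trans by (simp add: poly_iter3 algebra_simps)
  then show ?thesis by (simp add: v_def w_def power_mult)
qed

end

section \<open>Roots of the third iterate\<close>

context two_term_pole
begin

text \<open>The roots of \<open>iter3 = a\<close> are the first iterates for which the third one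
  returns to \<open>a\<close>, so \<open>iter3_small\<close> locates them. The leading coefficient
  is a unit and does not affect sizes.\<close>

lemma iter3_split:
  obtains Y where "size Y = d ^ 2"
    and "\<And>u. poly iter3 u - a \<asymp> (\<Prod>y\<in>#Y. u - y)"
    and "\<And>y. y \<in># Y \<Longrightarrow> \<exists>z\<in>Z. near y z"
proof -
  define Q where "Q = iter3 + [:- a, 0:]"
  have "Polynomial.degree iter3 > 1" unfolding degree_iter3 using d_gt by (intro one_less_power) auto
  then have Q: "Polynomial.degree Q = d ^ 2" "Polynomial.lead_coeff Q = Polynomial.lead_coeff iter3"
    unfolding Q_def using degree_add_linear[of iter3 "- a" 0] degree_iter3 by simp_all
  have "Q \<noteq> 0" using Q(1) d_gt by auto
  then obtain Y where Y: "size Y = d ^ 2"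
    "Q = smult (Polynomial.lead_coeff Q) (\<Prod>y\<in>#Y. [:- y, 1:])"
    using alg_closed_imp_factorization Q(1) by metis
  have poly_Q: "poly Q u = poly iter3 u - a" for u by (simp add: Q_def)
  have eq: "poly Q u = Polynomial.lead_coeff Q * (\<Prod>y\<in>#Y. u - y)" for u
    by (subst Y(2)) (simp add: poly_prod_mset)
  show thesis
  proof (rule that[OF Y(1)])
    show "poly iter3 u - a \<asymp> (\<Prod>y\<in>#Y. u - y)" for u
      using veq_mult[OF lead_coeff_iter3 veq_refl, of "\<Prod>y\<in>#Y. u - y"]
      by (simp add: poly_Q [symmetric] eq Q(2))
    show "\<exists>z\<in>Z. near y z" if "y \<in># Y" for y
    proof (rule iter3_small)
      have "poly Q y = 0" unfolding eq using that by (auto simp: prod_mset_zero_iff)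
      then show "poly iter3 y \<preceq> a" by (simp add: poly_Q)
    qed
  qed
qed

text \<open>
  The number of roots of \<open>iter3 = a\<close> near \<open>z\<close> is found by comparing the two sizes of \<open>iter3 - a\<close> at
  \<open>z + 1\<close> and \<open>z + inverse a\<close>: only the factors of the roots near \<open>z\<close> change between the points.
\<close>
lemma count_near_roots:
  assumes z: "z \<in> Z"
    and Y: "\<And>u. poly iter3 u - a \<asymp> (\<Prod>y\<in>#Y. u - y)" "\<And>y. y \<in># Y \<Longrightarrow> \<exists>z\<in>Z. near y z"
  shows "size (filter_mset (\<lambda>y. near y z) Y) = q * d"
proof -
  define N where "N = filter_mset (\<lambda>y. near y z) Y"
  define N' where "N' = filter_mset (\<lambda>y. \<not> near y z) Y"
  have Y_eq: "Y = N + N'" by (simp add: N_def N'_def)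
  have split: "poly iter3 u - a \<asymp> (\<Prod>y\<in>#N. u - y) * (\<Prod>y\<in>#N'. u - y)" for u
    using Y(1)[of u] by (simp add: Y_eq)
  define K where "K = (\<Prod>y\<in>#N'. z - y)"
  \<comment> \<open>Roots near another point of \<open>Z\<close> are more than \<open>1\<close> away
    from \<open>z\<close>, so a shift by \<open>e\<close> does not change their factors in
    size.\<close>
  have far: "(\<Prod>y\<in>#N'. (z + e) - y) \<asymp> K" if e: "e \<preceq> 1" for e
    unfolding K_def
  proof (rule veq_prod_mset)
    fix y assume "y \<in># N'"
    then obtain z' where z': "z' \<in> Z" "near y z'" "z' \<noteq> z" using Y(2) by (auto simp: N'_def)
    note e
    also have "1 \<prec> z' - z" using z' z by (intro Z_distance)
    also have "z' - z \<asymp> y - z" using Z_distance_shift[of z' z y] z' z near_vle veq_sym by blast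
    also have "y - z \<asymp> z - y" by (rule veq_minus_commute)
    finally have "(z - y) + e \<asymp> z - y" by (rule veq_add)
    then show "(z + e) - y \<asymp> z - y" by (simp add: algebra_simps)
  qed
  have ia: "inverse a \<preceq> 1"
    using vle_mult[OF vle_refl vlt_imp_vle[OF a], of "inverse a"] a_nonzero by simp
  have one_root: "(z + 1) - y \<asymp> 1" "(z + inverse a) - y \<asymp> inverse a" if "y \<in># N" for y
  proof -
    have n: "(y - z) * a ^ (s1 - 2) \<preceq> 1" using that by (simp add: N_def near_def)
    \<comment> \<open>The radius of \<open>near\<close> is strictly below the size of
      \<open>inverse a\<close>, because \<open>s1 - 2 \<ge> 2\<close>.\<close>
    have *: "(y - z) * a \<prec> 1"
    proof (rule ccontr)
      assume "\<not> (y - z) * a \<prec> 1"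
      then have "1 * a ^ (s1 - 3) \<preceq> ((y - z) * a) * a ^ (s1 - 3)"
        by (intro vle_mult) (auto simp: not_vlt)
      also have "((y - z) * a) * a ^ (s1 - 3) = (y - z) * a ^ (s1 - 2)"
      proof -
        have "s1 - 2 = Suc (s1 - 3)" using s1_bounds by simp
        then show ?thesis by (simp add: ac_simps)
      qed
      also note n
      also have "1 \<prec> a ^ (s1 - 3)" using s1_bounds(3) by (intro one_vlt_power[OF a]) simp
      finally show False by simp
    qed
    then have "((y - z) * a) * inverse a \<prec> 1 * inverse a"
      using a_nonzero by (subst vlt_mult_cancel_right) auto
    then have 1: "y - z \<prec> inverse a" using a_nonzero by (simp add: mult.assoc)
    with ia have 2: "y - z \<prec> 1" by (blast intro: vlt_vle_trans)
    show "(z + 1) - y \<asymp> 1" using veq_diff[OF 2] by (simp add: algebra_simps)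
    show "(z + inverse a) - y \<asymp> inverse a" using veq_diff[OF 1] by (simp add: algebra_simps)
  qed
  have "(\<Prod>y\<in>#N. (z + 1) - y) \<asymp> (\<Prod>y\<in>#N. 1)" by (intro veq_prod_mset one_root)
  then have n1: "(\<Prod>y\<in>#N. (z + 1) - y) \<asymp> 1" by simp
  have "(\<Prod>y\<in>#N. (z + inverse a) - y) \<asymp> (\<Prod>y\<in>#N. inverse a)" by (intro veq_prod_mset one_root)
  then have n2: "(\<Prod>y\<in>#N. (z + inverse a) - y) \<asymp> inverse a ^ size N" by (simp add: prod_mset_constant)
  have s1_eq: "s1 - 1 = Suc (s1 - 2)" using s1_bounds by simp
  have "(a ^ (s1 - 1)) ^ (q * d) \<asymp> poly iter3 (z + 1) - a"
    using veq_sym[OF iter3_near_root[OF z vle_refl]] a_power_vlt[of 1 "s1 - 1"] s1_bounds by simp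
  also have "\<dots> \<asymp> 1 * K" using split veq_mult[OF n1 far[OF vle_refl]] by (rule veq_trans)
  finally have 1: "(a ^ (s1 - 1)) ^ (q * d) \<asymp> K" by simp
  have shrink: "a ^ (s1 - 1) * inverse a = a ^ (s1 - 2)" using a_nonzero unfolding s1_eq by simp
  have "(a ^ (s1 - 2)) ^ (q * d) \<asymp> poly iter3 (z + inverse a) - a"
    using veq_sym[OF iter3_near_root[OF z ia]] a_power_vlt[of 1 "s1 - 2"] s1_bounds unfolding shrink by simp
  also have "\<dots> \<asymp> inverse a ^ size N * K" using split veq_mult[OF n2 far[OF ia]] by (rule veq_trans)
  finally have "a ^ size N * (a ^ (s1 - 2)) ^ (q * d) \<asymp> a ^ size N * (inverse a ^ size N * K)"
    by (intro veq_mult) auto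
  also have "\<dots> = K" using a_nonzero by (simp add: power_inverse)
  also have "K \<asymp> (a ^ (s1 - 1)) ^ (q * d)" using 1 by (rule veq_sym)
  finally have "a ^ (size N + (s1 - 2) * (q * d)) \<asymp> a ^ ((s1 - 1) * (q * d))"
    by (simp add: power_add power_mult)
  then have "size N + (s1 - 2) * (q * d) = (s1 - 1) * (q * d)" by (rule power_veq_imp_eq[OF a])
  then have "size N = q * d" unfolding s1_eq by simp
  then show ?thesis by (simp add: N_def)
qed

text \<open>\<open>T\<close> is \<open>iter3 - a\<close>, made monic, without its
  \<open>q * d\<close> roots near \<open>z0\<close>. At \<open>u\<close> near another
  \<open>z\<close> the removed factors have the size of \<open>z - z0\<close>, and their product is
  at least \<open>a ^ 2\<close>; as \<open>iter3 - a\<close> is at most \<open>a\<close>,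
  \<open>T\<close> is at most \<open>inverse a\<close>.\<close>

lemma exists_small_polynomial:
  assumes z0: "z0 \<in> Z"
  shows "\<exists>T. 0 < Polynomial.degree T \<and> Polynomial.degree T \<le> d ^ 2 \<and> Polynomial.lead_coeff T = 1 \<and>
    (\<forall>u z. poly iter3 u \<preceq> a \<longrightarrow> z \<in> Z \<longrightarrow> z \<noteq> z0 \<longrightarrow> near u z \<longrightarrow> poly T u * a \<preceq> 1)"
proof -
  obtain Y where Y: "size Y = d ^ 2" "\<And>u. poly iter3 u - a \<asymp> (\<Prod>y\<in>#Y. u - y)"
    "\<And>y. y \<in># Y \<Longrightarrow> \<exists>z\<in>Z. near y z" using iter3_split by blast
  define N where "N = filter_mset (\<lambda>y. near y z0) Y"
  define N' where "N' = filter_mset (\<lambda>y. \<not> near y z0) Y"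
  define T where "T = (\<Prod>y\<in>#N'. [:- y, 1:])"
  have Y_eq: "Y = N + N'" by (simp add: N_def N'_def)
  have size_N: "size N = q * d" unfolding N_def using count_near_roots[OF z0 Y(2,3)] .
  have degree_T: "Polynomial.degree (\<Prod>y\<in>#M. [:- y, 1:]) = size M"
    and lead_T: "Polynomial.lead_coeff (\<Prod>y\<in>#M. [:- y, 1:]) = 1" for M :: "'k multiset"
  proof (induction M)
    case (add x M)
    have "(\<Prod>y\<in>#M. [:- y, 1:]) \<noteq> (0 :: 'k poly)" by (auto simp: prod_mset_zero_iff)
    then show "Polynomial.degree (\<Prod>y\<in>#add_mset x M. [:- y, 1:]) = size (add_mset x M)"
      using add by (simp only: image_mset_add_mset prod_mset.add_mset) (subst degree_mult_eq, auto)
    show "Polynomial.lead_coeff (\<Prod>y\<in>#add_mset x M. [:- y, 1:]) = 1"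
      using add by (simp only: image_mset_add_mset prod_mset.add_mset lead_coeff_mult) simp
  qed auto
  have "size N' + q * d = d * d" using Y(1) size_N by (simp add: Y_eq power2_eq_square)
  moreover have "q * d < d * d" using m_gt d_gt q_pos by (simp add: d_def)
  ultimately have size_N': "0 < size N'" "size N' \<le> d ^ 2"
    unfolding power2_eq_square by linarith+
  have "poly T u * a \<preceq> 1" if u: "poly iter3 u \<preceq> a" "z \<in> Z" "z \<noteq> z0" "near u z" for u z
  proof -
    have poly_T: "poly T u = (\<Prod>y\<in>#N'. u - y)" by (simp add: T_def poly_prod_mset)
    have root: "u - y \<asymp> z - z0" if "y \<in># N" for y
    proof -
      have 1: "u - z0 \<asymp> z - z0" using Z_distance_shift[of z z0 u] u z0 near_vle by blast
      have "y - z0 \<preceq> 1" using that near_vle by (simp add: N_def)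
      also have "1 \<prec> z - z0" using u z0 by (intro Z_distance)
      also have "z - z0 \<asymp> u - z0" using 1 by (rule veq_sym)
      finally have "(u - z0) - (y - z0) \<asymp> u - z0" by (rule veq_diff)
      also note 1
      finally show ?thesis by simp
    qed
    have "(\<Prod>y\<in>#N. u - y) \<asymp> (\<Prod>y\<in>#N. z - z0)" by (intro veq_prod_mset root)
    then have near_prod: "(\<Prod>y\<in>#N. u - y) \<asymp> (z - z0) ^ (q * d)" by (simp add: prod_mset_constant size_N)
    have "poly T u * (z - z0) ^ (q * d) \<asymp> poly T u * (\<Prod>y\<in>#N. u - y)"
      by (intro veq_mult veq_sym[OF near_prod]) auto
    also have "\<dots> = (\<Prod>y\<in>#Y. u - y)" by (simp add: poly_T Y_eq mult.commute)
    also have "\<dots> \<asymp> poly iter3 u - a" by (rule veq_sym[OF Y(2)])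
    also have "\<dots> \<preceq> a" using u by (intro vle_diff) auto
    \<comment> \<open>The power \<open>r - 1\<close> is taken because the separation of
      \<open>Z\<close> is a bound on \<open>(z - z0) ^ (r - 1)\<close>.\<close>
    finally have "(poly T u * (z - z0) ^ (q * d)) ^ (r - 1) \<preceq> a ^ (r - 1)" by (rule vle_power)
    then have *: "poly T u ^ (r - 1) * ((z - z0) ^ (r - 1)) ^ (q * d) \<preceq> a ^ (r - 1)"
      by (simp add: power_mult_distrib power_mult [symmetric] mult.commute)
    have qd: "2 * (r - 1) \<le> q * d"
    proof -
      have "2 * (r - 1) \<le> d" using s1_bounds m_le_d by simp
      also have "d \<le> q * d" using q_pos by simp
      finally show ?thesis .
    qed
    have "poly T u ^ (r - 1) * a ^ (2 * (r - 1)) \<preceq> poly T u ^ (r - 1) * a ^ (q * d)"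
      using qd by (intro vle_mult a_power_vle) auto
    also have "\<dots> \<preceq> poly T u ^ (r - 1) * ((z - z0) ^ (r - 1)) ^ (q * d)"
      using u z0 by (intro vle_mult vle_power Z_separated) auto
    also note *
    finally have "(poly T u * a) ^ (r - 1) * a ^ (r - 1) \<preceq> 1 * a ^ (r - 1)"
      by (simp add: power_mult_distrib mult_2 power_add ac_simps)
    then have "(poly T u * a) ^ (r - 1) \<preceq> 1 ^ (r - 1)"
      using a_nonzero vle_mult_cancel_right[of "a ^ (r - 1)" _ 1] by simp
    then show ?thesis by (rule vle_power_cancel) (use r_ge in simp)
  qed
  then show ?thesis
    using size_N' degree_T[of N'] lead_T[of N'] by (intro exI[of _ T]) (auto simp: T_def)
qed

end

section \<open>The discriminant of a set of parameters at a pole\<close>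

lemma discriminant_translate:
  "discriminant ((\<lambda>x. x + c) ` S) = discriminant (S :: 'k :: field set)"
proof -
  have "(\<Prod>y\<in>(\<lambda>x. x + c) ` S - {x + c}. x + c - y) = (\<Prod>y\<in>S - {x}. x - y)" for x
  proof -
    have "(\<lambda>x. x + c) ` S - {x + c} = (\<lambda>x. x + c) ` (S - {x})" by auto
    then show ?thesis by (simp add: prod.reindex inj_on_def)
  qed
  then show ?thesis by (simp add: discriminant_def prod.reindex inj_on_def)
qed

context two_term_pole
begin

text \<open>In Fekete's bound \<open>h\<close> is the total exponent of a polynomial of degree
  \<open>d ^ 2\<close>, and \<open>w\<close> bounds the total of the remainders. The exponent
  \<open>h - w - 1\<close> is the largest with \<open>w + n < h\<close>, as required when a root is
  missed; when all are hit, \<open>h + w < 2 * n\<close> is required, which is exactly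
  \<open>3 * w + 2 < h\<close>.\<close>

lemma discriminant_vlt_one:
  fixes b :: 'k and \<Lambda> S :: "'k set"
  defines "e \<equiv> f a - f b"
  defines "h \<equiv> (\<Sum>j<card S. j div d ^ 2)" and "w \<equiv> card S * d ^ 2"
  assumes prep: "\<And>c. c \<in> \<Lambda> \<Longrightarrow> preperiodic (\<lambda>x. f x + c) a"
      "\<And>c. c \<in> \<Lambda> \<Longrightarrow> preperiodic (\<lambda>x. f x + c) b"
    and S: "S \<subseteq> \<Lambda>" "finite S" and large: "3 * w + 2 < h"
  shows "discriminant S * (e ^ (h - w - 1)) ^ 2 \<prec> 1"
proof -
  define n where "n = h - w - 1"
  have b_veq: "b \<asymp> a" if "c \<in> \<Lambda>" for c
  proof -
    have "\<not> c \<preceq> 1" using preperiodic_integral_iff[OF prep(1)[OF that]] a by (simp add: vlt_def)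
    then have b: "1 \<prec> b" using preperiodic_integral_iff[OF prep(2)[OF that]] by (simp add: vlt_def)
    have "b ^ d \<asymp> c" using preperiodic_parameter_veq[OF prep(2)[OF that] b] by (rule veq_sym)
    also have "c \<asymp> a ^ d" using preperiodic_parameter_veq[OF prep(1)[OF that] a] .
    finally show ?thesis by (rule veq_power_cancel) (use d_gt in simp)
  qed
  have orbit_a: "f a + c \<preceq> a" "f (f a + c) + c \<preceq> a" "f (f (f a + c) + c) + c \<preceq> a" if "c \<in> \<Lambda>" for c
    using preperiodic_orbit_vle[OF prep(1)[OF that] a, of 1]
      preperiodic_orbit_vle[OF prep(1)[OF that] a, of 2]
      preperiodic_orbit_vle[OF prep(1)[OF that] a, of 3] by (simp_all add: numeral_2_eq_2 numeral_3_eq_3)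
  have orbit_b: "f b + c \<preceq> a" "f (f b + c) + c \<preceq> a" if "c \<in> \<Lambda>" for c
  proof -
    have b: "1 \<prec> b" using a b_veq[OF that] veq_sym vlt_veq_trans by blast
    show "f b + c \<preceq> a" "f (f b + c) + c \<preceq> a"
      using preperiodic_orbit_vle[OF prep(2)[OF that] b, of 1]
        preperiodic_orbit_vle[OF prep(2)[OF that] b, of 2] b_veq[OF that] vle_veq_trans
      by (simp_all add: numeral_2_eq_2)
  qed
  define U where "U = (\<lambda>c. c + f a) ` S"
  have card_U: "card U = card S" unfolding U_def by (intro card_image) (auto simp: inj_on_def)
  have U: "finite U" "discriminant U = discriminant S"
    using S discriminant_translate by (auto simp: U_def)
  have iter3_vle: "poly iter3 (c + f a) \<preceq> a" and u_vle: "c + f a \<preceq> a" if "c \<in> \<Lambda>" for c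
    using orbit_a[OF that] by (simp_all add: poly_iter3 poly_iter2 add.commute)
  have mod_le: "(\<Sum>j<card S. j mod D) \<le> w" if "0 < D" "D \<le> d ^ 2" for D
  proof -
    have "(\<Sum>j<card S. j mod D) \<le> (\<Sum>j<card S. d ^ 2)"
      using that by (intro sum_mono) (meson less_imp_le mod_less_divisor order.trans)
    then show ?thesis by (simp add: w_def)
  qed
  have d2: "0 < d ^ 2" using d_gt by simp
  have "S \<noteq> {}" using large by (auto simp: h_def)
  have "discriminant S * (e ^ n) ^ 2 \<prec> 1"
  proof (cases "\<forall>z\<in>Z. \<exists>c\<in>\<Lambda>. near (c + f a) z")
    \<comment> \<open>All roots are approached: the discriminant may reach
      \<open>a ^ (2 * (h + w))\<close>, but \<open>e * a ^ 2 \<preceq> 1\<close> gains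
      \<open>a ^ (4 * n)\<close>.\<close>
    case True
    then obtain c where c: "\<And>z. z \<in> Z \<Longrightarrow> c z \<in> \<Lambda> \<and> near (c z + f a) z" by metis
    have "e * a ^ 2 \<preceq> 1"
    proof (rule shift_small_if_all_roots_hit)
      fix z assume z: "z \<in> Z"
      show "near (c z + f a) z" "c z + f a \<preceq> a" using c z u_vle by auto
      let ?u = "c z + f a" and ?v = "c z + f b"
      have "f ?u - f ?v = (f ?u + c z) - (f ?v + c z)" by simp
      also have "\<dots> \<preceq> a"
        using orbit_a orbit_b c z by (intro vle_diff) (auto simp: add.commute)
      finally have "f ?u - f ?v \<preceq> a" .
      moreover have "((g ?u - g ?v) + g ?v) ^ q = (g ?u - g ?v) ^ q + g ?v ^ q"
        using prime_CHAR by (rule freshmans_dream') (simp add: q_def)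
      ultimately have "(g ?u - g ?v) ^ q \<preceq> a" by (simp add: f_def)
      also have "a \<preceq> a ^ q" using a_power_vle[of 1 q] q_pos by simp
      finally have "g ?u - g ?v \<preceq> a" by (rule vle_power_cancel) (use q_pos in simp)
      then show "g ?u - g (?u - e) \<preceq> a" by (simp add: e_def algebra_simps)
    qed
    then have "((e * a ^ 2) ^ n) ^ 2 \<preceq> (1 ^ n) ^ 2" by (intro vle_power)
    then have e: "(e ^ n) ^ 2 * a ^ (4 * n) \<preceq> 1"
      by (simp add: power_mult_distrib power_mult [symmetric] ac_simps)
    define T where "T = smult (inverse (Polynomial.lead_coeff iter3)) iter3"
    have lc: "Polynomial.lead_coeff iter3 \<noteq> 0" using lead_coeff_iter3 by (metis one_neq_zero veq_zero_iff(2))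
    have ilc: "inverse (Polynomial.lead_coeff iter3) \<preceq> 1"
    proof -
      have "inverse (Polynomial.lead_coeff iter3) * 1 \<preceq>
          inverse (Polynomial.lead_coeff iter3) * Polynomial.lead_coeff iter3"
        using lead_coeff_iter3 by (intro vle_mult) (auto simp: veq_def)
      with lc show ?thesis by simp
    qed
    have "discriminant U \<preceq>
        (a ^ (\<Sum>j<card U. j div d ^ 2) * a ^ (\<Sum>j<card U. j mod d ^ 2)) ^ 2"
    proof (rule discriminant_vle_powers[OF U(1) _ _ d2])
      show "Polynomial.degree T = d ^ 2" "Polynomial.lead_coeff T = 1"
        using lc degree_iter3 by (auto simp: T_def)
      fix u assume "u \<in> U"
      then obtain c where "c \<in> \<Lambda>" "u = c + f a" using S by (auto simp: U_def)
      then show "u \<preceq> a" "poly T u \<preceq> a"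
        using u_vle iter3_vle vle_mult[OF ilc] by (auto simp: T_def)
    qed
    also have "\<dots> = a ^ (2 * (h + (\<Sum>j<card S. j mod d ^ 2)))"
      by (simp add: card_U h_def power_add [symmetric] power_mult [symmetric] mult.commute)
    also have "\<dots> \<preceq> a ^ (2 * (h + w))" using mod_le[OF d2] by (intro a_power_vle) simp
    finally have "discriminant S * ((e ^ n) ^ 2 * a ^ (4 * n)) \<preceq> a ^ (2 * (h + w)) * 1"
      unfolding U(2) using e by (rule vle_mult)
    also have "a ^ (2 * (h + w)) * 1 \<prec> a ^ (4 * n) * 1"
      using large unfolding mult_1_right by (intro a_power_vlt) (simp add: n_def)
    finally have "(discriminant S * (e ^ n) ^ 2) * a ^ (4 * n) \<prec> 1 * a ^ (4 * n)" by (simp add: mult.assoc)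
    then show ?thesis using a_nonzero vlt_mult_cancel_right[of "a ^ (4 * n)" _ 1] by simp
  next
    \<comment> \<open>A root is missed: the powers of \<open>T\<close> gain
      \<open>a ^ (2 * h')\<close> and the remainders lose at most \<open>a ^ (2 * w)\<close>, which
      outweighs the possible loss \<open>a ^ (2 * n)\<close> from
      \<open>e \<preceq> a\<close>.\<close>
    case False
    then obtain z0 where z0: "z0 \<in> Z" "\<And>c. c \<in> \<Lambda> \<Longrightarrow> \<not> near (c + f a) z0" by auto
    from exists_small_polynomial[OF z0(1)] obtain T where T: "0 < Polynomial.degree T"
      "Polynomial.degree T \<le> d ^ 2" "Polynomial.lead_coeff T = 1"
      "\<And>u z. poly iter3 u \<preceq> a \<Longrightarrow> z \<in> Z \<Longrightarrow> z \<noteq> z0 \<Longrightarrow> near u z \<Longrightarrow> poly T u * a \<preceq> 1" by blast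
    define D where "D = Polynomial.degree T"
    have e: "e \<preceq> a"
    proof -
      from \<open>S \<noteq> {}\<close> S obtain c where "c \<in> \<Lambda>" by auto
      then have "(f a + c) - (f b + c) \<preceq> a" using orbit_a orbit_b by (intro vle_diff)
      then show ?thesis by (simp add: e_def)
    qed
    define h' where "h' = (\<Sum>j<card S. j div D)"
    have "h \<le> h'" unfolding h_def h'_def D_def using T by (intro sum_mono div_le_mono2)
    have "discriminant U \<preceq>
        (inverse a ^ (\<Sum>j<card U. j div D) * a ^ (\<Sum>j<card U. j mod D)) ^ 2"
    proof (rule discriminant_vle_powers[OF U(1) _ T(3)])
      show "Polynomial.degree T = D" "0 < D" using T by (auto simp: D_def)
      fix u assume "u \<in> U"
      then obtain c where c: "c \<in> \<Lambda>" "u = c + f a" using S by (auto simp: U_def)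
      then show "u \<preceq> a" using u_vle by simp
      obtain z where "z \<in> Z" "near u z" using iter3_small iter3_vle c by blast
      then have "poly T u * a \<preceq> 1" using T(4) iter3_vle z0(2) c by blast
      then have "(poly T u * a) * inverse a \<preceq> 1 * inverse a" by (intro vle_mult) auto
      then show "poly T u \<preceq> inverse a" using a_nonzero by (simp add: mult.assoc)
    qed
    also have "\<dots> = (inverse a ^ h' * a ^ (\<Sum>j<card S. j mod D)) ^ 2"
      by (simp add: card_U h'_def)
    also have "\<dots> \<preceq> (inverse a ^ h' * a ^ w) ^ 2"
      using mod_le[of D] T by (intro vle_power vle_mult a_power_vle) (auto simp: D_def)
    finally have "discriminant S * (e ^ n) ^ 2 \<preceq> (inverse a ^ h' * a ^ w) ^ 2 * (a ^ n) ^ 2"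
      unfolding U(2) using e by (intro vle_mult vle_power)
    also have "\<dots> = (inverse a ^ h' * a ^ (w + n)) ^ 2" by (simp add: power_mult_distrib power_add)
    also have "\<dots> \<prec> 1 ^ 2"
    proof (rule vlt_power)
      have "inverse a ^ h' * a ^ (w + n) \<prec> inverse a ^ h' * a ^ h'"
        using a_nonzero large \<open>h \<le> h'\<close> by (subst vlt_mult_cancel_left) (auto intro: a_power_vlt simp: n_def)
      then show "inverse a ^ h' * a ^ (w + n) \<prec> 1" using a_nonzero by (simp add: power_inverse)
    qed simp
    finally show ?thesis by simp
  qed
  then show ?thesis by (simp add: n_def)
qed

end

section \<open>Preperiodic parameters\<close>

text \<open>The sum is quadratic in \<open>M\<close>, the left side linear. For
  \<open>M = 2 * L\<close> the upper half of the range alone has \<open>L\<close> terms of size at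
  least \<open>6 * D + 3\<close>.\<close>

lemma div_sum_large:
  fixes D :: nat
  assumes "D > 0"
  shows "\<exists>M. 3 * (M * D) + 2 < (\<Sum>j<M. j div D)"
proof -
  define L where "L = D * (6 * D + 3)"
  have "L * (6 * D + 3) = (\<Sum>j\<in>{L..<2 * L}. 6 * D + 3)" by simp
  also have "\<dots> \<le> (\<Sum>j\<in>{L..<2 * L}. j div D)"
  proof (intro sum_mono)
    fix j assume "j \<in> {L..<2 * L}"
    then have "L div D \<le> j div D" by (intro div_le_mono) simp
    with assms show "6 * D + 3 \<le> j div D" by (simp add: L_def)
  qed
  also have "\<dots> \<le> (\<Sum>j<2 * L. j div D)" by (intro sum_mono2) auto
  finally have "L * (6 * D + 3) \<le> (\<Sum>j<2 * L. j div D)" .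
  moreover have "L > 0" using assms by (simp add: L_def)
  then have "3 * (2 * L * D) + 2 < L * (6 * D + 3)" by (simp add: algebra_simps)
  ultimately show ?thesis by (intro exI[of _ "2 * L"]) linarith
qed

text \<open>If it were finite, one power of Frobenius would fix all its elements, but a root of
  \<open>X ^ (CHAR('k) ^ k) - X - 1\<close> is algebraic over the prime field and is not
  fixed.\<close>

lemma infinite_Fp_bar:
  assumes p: "Factorial_Ring.prime CHAR('k)"
  shows "infinite (Fp_bar :: 'k :: alg_closed_field set)"
proof
  assume "finite (Fp_bar :: 'k set)"
  then obtain k where k: "k > 0" "\<forall>x\<in>Fp_bar. (x :: 'k) ^ (CHAR('k) ^ k) = x"
    using common_Frobenius_period[OF p] by blast
  have gt: "CHAR('k) ^ k > 1" using k p prime_gt_1_nat by (metis one_less_power)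
  define Q where "Q = Polynomial.monom (1::'k) (CHAR('k) ^ k) - [:1, 1:]"
  have "coeff Q (CHAR('k) ^ k) = 1"
    using gt by (subst Q_def, cases "CHAR('k) ^ k") (auto simp: coeff_pCons split: nat.splits)
  then have "Polynomial.degree Q > 0" "Q \<noteq> 0" using gt le_degree[of Q "CHAR('k) ^ k"] by auto
  then obtain x where x: "poly Q x = 0" using alg_closed_imp_poly_has_root by blast
  have "\<forall>i. coeff Q i \<in> \<int>" by (auto simp: Q_def coeff_pCons split: nat.splits)
  with x \<open>Q \<noteq> 0\<close> have "x \<in> Fp_bar" unfolding Fp_bar_def by blast
  with k x show False by (simp add: Q_def poly_monom)
qed

lemma preperiodic_iff_step: "preperiodic g x \<longleftrightarrow> preperiodic g (g x)"
proof
  show "preperiodic g (g x)" if "preperiodic g x" using preperiodic_step[OF that, of 1] by simp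
  assume "preperiodic g (g x)"
  moreover have "(g ^^ n) x \<in> insert x (range (\<lambda>n. (g ^^ n) (g x)))" for n
    by (cases n) (auto simp: funpow_swap1)
  then have "range (\<lambda>n. (g ^^ n) x) \<subseteq> insert x (range (\<lambda>n. (g ^^ n) (g x)))" by blast
  ultimately show "preperiodic g x"
    unfolding preperiodic_def using finite_subset finite_insert by blast
qed

lemma periodic_imp_preperiodic:
  assumes "(g ^^ n) x = x" "n > 0"
  shows "preperiodic g x"
proof -
  have "(g ^^ i) x \<in> (\<lambda>i. (g ^^ i) x) ` {..<n}" for i
    using funpow_mod_eq[OF assms(1), of i] assms(2) by (metis imageI lessThan_iff mod_less_divisor)
  then have "range (\<lambda>i. (g ^^ i) x) \<subseteq> (\<lambda>i. (g ^^ i) x) ` {..<n}" by blast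
  then show ?thesis unfolding preperiodic_def by (rule finite_subset) simp
qed

lemma fixed_if_coprime_periods:
  assumes "(g ^^ m) x = x" "(g ^^ n) x = x" "coprime m n" "n > 1"
  shows "g x = x"
proof -
  have "m \<noteq> 0" using assms(3,4) by (intro notI) simp
  then obtain i j where "m * i = n * j + 1"
    using bezout_nat[of m n] assms(3) by (auto simp: coprime_iff_gcd_eq_1)
  then have "(g ^^ (m * i)) x = (g ^^ (n * j + 1)) x" by simp
  also have "\<dots> = (g ^^ ((n * j + 1) mod n)) x" by (rule funpow_mod_eq[OF assms(2), symmetric])
  also have "(n * j + 1) mod n = 1" using \<open>n > 1\<close> by (simp only: mod_mult_self4 mod_less)
  finally show ?thesis using funpow_mod_eq[OF assms(1), of "m * i"] by simp
qed

section \<open>From local bounds to the equality of images\<close>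

context two_term
begin

lemma valuation: "valuation_ring (V :: 'k set) \<Longrightarrow> two_term_valuation b1 b2 k s1 s2 V"
  by (simp add: two_term_valuation_def two_term_axioms)

text \<open>\<open>x\<close> is integral at every valuation ring: it is below \<open>1\<close> at
  poles of \<open>a\<close>, and elsewhere \<open>b\<close> and the parameters in \<open>S\<close>
  are integral along with \<open>a\<close>. So \<open>x\<close> is algebraic over the prime field;
  if nonzero it would be a unit everywhere, also at a pole of \<open>a\<close>.\<close>

lemma f_eq_if_infinite:
  assumes inf: "infinite {c. preperiodic (\<lambda>x. f x + c) a \<and> preperiodic (\<lambda>x. f x + c) b}" (is "infinite ?\<Lambda>")
    and a: "a \<notin> Fp_bar"
  shows "f a = f b"
proof -
  obtain M where M: "3 * (M * d ^ 2) + 2 < (\<Sum>j<M. j div d ^ 2)"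
    using div_sum_large[of "d ^ 2"] d_gt by (metis less_nat_zero_code neq0_conv zero_less_power)
  obtain S where S: "S \<subseteq> ?\<Lambda>" "finite S" "card S = M"
    using infinite_arbitrarily_large[OF inf] by blast
  define n where "n = (\<Sum>j<M. j div d ^ 2) - M * d ^ 2 - 1"
  define x where "x = discriminant S * ((f a - f b) ^ n) ^ 2"
  have small: "\<not> valuation_ring.vle V 1 x" if V: "valuation_ring V" "a \<notin> V" for V
  proof -
    interpret two_term_valuation b1 b2 l k s1 s2 V using V by (intro valuation)
    interpret two_term_pole b1 b2 l k s1 s2 V a
      by unfold_locales (use V in \<open>simp add: vlt_def vle_one_iff\<close>)
    have "vlt (discriminant S * ((f a - f b) ^ n) ^ 2) 1"
      unfolding n_def S(3) [symmetric]
    proof (rule discriminant_vlt_one)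
      show "S \<subseteq> ?\<Lambda>" "finite S" using S by simp_all
      show "3 * (card S * d ^ 2) + 2 < (\<Sum>j<card S. j div d ^ 2)" unfolding S(3) by (rule M)
    qed blast+
    then show ?thesis by (simp add: x_def vlt_def)
  qed
  have "x \<in> Fp_bar"
  proof (rule ccontr)
    assume "x \<notin> Fp_bar"
    then obtain V where V: "valuation_ring V" "x \<notin> V" using exists_valuation_ring[OF prime_CHAR] by blast
    interpret two_term_valuation b1 b2 l k s1 s2 V using V by (intro valuation)
    show False
    proof (cases "a \<in> V")
      case False
      then have "vlt x 1" using small V by (simp add: vlt_def)
      then have "vle x 1" by (rule vlt_imp_vle)
      with V show False by (simp add: vle_one_iff)
    next
      case True
      have c: "c \<in> V" "b \<in> V" if "c \<in> S" for c
      proof -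
        from that S(1) have "preperiodic (\<lambda>x. f x + c) a" "preperiodic (\<lambda>x. f x + c) b" by auto
        from this[THEN preperiodic_integral_iff] True show "c \<in> V" "b \<in> V"
          by (simp_all add: vle_one_iff)
      qed
      have "S \<noteq> {}" using S(3) M by (intro notI) simp
      with c have "vle b 1" by (auto simp: vle_one_iff)
      then have "vle (f a - f b) 1" using True by (intro vle_diff f_vle_one) (auto simp: vle_one_iff)
      moreover have "vle (discriminant S) (\<Prod>x\<in>S. \<Prod>y\<in>S - {x}. 1)"
        unfolding discriminant_def
        by (intro vle_prod vle_diff) (auto simp: vle_one_iff c)
      ultimately have "vle x ((\<Prod>x\<in>S. \<Prod>y\<in>S - {x}. 1) * (1 ^ n) ^ 2)"
        unfolding x_def by (intro vle_mult vle_power)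
      with V show False by (simp add: vle_one_iff)
    qed
  qed
  moreover obtain V where V: "valuation_ring V" "a \<notin> V" using exists_valuation_ring[OF prime_CHAR a] by blast
  then interpret two_term_valuation b1 b2 l k s1 s2 V by (intro valuation)
  have "\<not> vle 1 x" using small V by simp
  ultimately have "x = 0" using Fp_bar_veq_one[OF prime_CHAR, of x] by (auto simp: veq_def)
  then show ?thesis using discriminant_nonzero[OF S(2)] by (simp add: x_def)
qed

text \<open>At a pole of \<open>b\<close> the parameter would be a pole by \<open>b\<close> and
  integral by \<open>a\<close>.\<close>

lemma Fp_bar_transfer:
  assumes "preperiodic (\<lambda>x. f x + c) a" "preperiodic (\<lambda>x. f x + c) b" "a \<in> Fp_bar"
  shows "b \<in> Fp_bar"
proof (rule ccontr)
  assume "b \<notin> Fp_bar"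
  then obtain V where V: "valuation_ring V" "b \<notin> V" using exists_valuation_ring[OF prime_CHAR] by blast
  then interpret two_term_valuation b1 b2 l k s1 s2 V by (intro valuation)
  show False
    using assms V Fp_bar_subset[OF prime_CHAR, of a] preperiodic_integral_iff[of c] by (auto simp: vle_one_iff)
qed

lemma Fp_bar_fibre:
  assumes "f a = f b" "a \<in> Fp_bar"
  shows "b \<in> Fp_bar"
proof (rule ccontr)
  assume "b \<notin> Fp_bar"
  then obtain V where V: "valuation_ring V" "b \<notin> V" using exists_valuation_ring[OF prime_CHAR] by blast
  then interpret two_term_valuation b1 b2 l k s1 s2 V by (intro valuation)
  have b: "vlt 1 b" using V by (simp add: vlt_def vle_one_iff)
  then have "vlt 1 (b ^ d)" by (rule one_vlt_power) (use d_gt in simp)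
  also have "veq (b ^ d) (f b)" using f_veq[OF b] by (rule veq_sym)
  finally have "\<not> vle (f a) 1" by (simp add: vlt_def assms(1))
  with f_vle_one[of a] Fp_bar_subset[OF prime_CHAR assms(2)] show False by (simp add: vle_one_iff)
qed

text \<open>Some finite field contains \<open>a\<close>, \<open>c\<close>, \<open>b1\<close> and
  \<open>b2\<close>, hence the whole orbit.\<close>

lemma preperiodic_Fp_bar:
  assumes "c \<in> Fp_bar" "a \<in> Fp_bar"
  shows "preperiodic (\<lambda>x. f x + c) a"
proof -
  obtain j where j: "j > 0" "\<forall>x\<in>{a, c, b1, b2}. x ^ (CHAR('k) ^ j) = x"
    using common_Frobenius_period[OF prime_CHAR, of "{a, c, b1, b2}"] assms b1 b2 by auto
  define N where "N = CHAR('k) ^ j"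
  note add = freshmans_dream'[OF prime_CHAR N_def]
  have closed: "(f x + c) ^ N = f x + c" if "x ^ N = x" for x
  proof -
    have "g x ^ N = b1 ^ N * (x ^ N) ^ s1 + b2 ^ N * (x ^ N) ^ m"
      by (simp add: g_altdef add power_mult_distrib power_mult [symmetric] mult.commute)
    also have "\<dots> = g x" using that j by (simp add: g_altdef N_def)
    finally have "f x ^ N = f x" by (simp add: f_def power_mult [symmetric]) (metis mult.commute power_mult)
    then show ?thesis using j(2) by (simp only: add) (simp add: N_def)
  qed
  have "((\<lambda>x. f x + c) ^^ n) a \<in> {x. x ^ N = x}" for n
  proof (induction n)
    case 0
    then show ?case using j by (simp add: N_def)
  next
    case (Suc n)
    then show ?case using closed by simp
  qed
  then have "range (\<lambda>n. ((\<lambda>x. f x + c) ^^ n) a) \<subseteq> {x. x ^ N = x}" by blast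
  moreover have "finite {x :: 'k. x ^ N = x}"
  proof -
    define Q where "Q = Polynomial.monom (1::'k) N - Polynomial.monom 1 1"
    have "N > 1" using j prime_CHAR prime_gt_1_nat unfolding N_def by (metis one_less_power)
    then have "coeff Q N = 1" by (simp add: Q_def)
    then have "Q \<noteq> 0" by auto
    moreover have "{x. x ^ N = x} = {x. poly Q x = 0}" by (auto simp: Q_def poly_monom)
    ultimately show ?thesis using poly_roots_finite by simp
  qed
  ultimately show ?thesis unfolding preperiodic_def by (rule finite_subset)
qed

section \<open>Periodic parameters for a transcendental starting point\<close>

fun orbit_poly :: "'k \<Rightarrow> nat \<Rightarrow> 'k poly" where
  "orbit_poly a 0 = [:a:]"
| "orbit_poly a (Suc n) = pcompose (G ^ q) (orbit_poly a n) + [:0, 1:]"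

lemma poly_orbit_poly: "poly (orbit_poly a n) c = ((\<lambda>x. f x + c) ^^ n) a"
  by (induction n) (simp_all add: poly_pcompose f_def g_def)

lemma degree_orbit_poly: "Polynomial.degree (orbit_poly a (Suc n)) = d ^ n"
proof (induction n)
  case 0
  have "Polynomial.degree (pcompose (G ^ q) [:a:]) < Polynomial.degree ([:0, 1:] :: 'k poly)"
    by (simp add: degree_pcompose)
  then have "Polynomial.degree (pcompose (G ^ q) [:a:] + [:0, 1:]) = Polynomial.degree ([:0, 1:] :: 'k poly)"
    by (rule degree_add_eq_right)
  then show ?case by simp
next
  case (Suc n)
  have "G \<noteq> 0" using degree_G m_gt by auto
  then have deg: "Polynomial.degree (pcompose (G ^ q) (orbit_poly a (Suc n))) = d ^ Suc n"
    using Suc degree_G by (simp add: degree_pcompose degree_power_eq d_def del: orbit_poly.simps)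
  have "1 < d ^ Suc n" using d_gt by (intro one_less_power) auto
  then show ?case
    using deg by (subst orbit_poly.simps, subst degree_add_eq_left) (auto simp del: orbit_poly.simps)
qed

text \<open>If \<open>l > 0\<close>, the derivative of a power of Frobenius vanishes. If
  \<open>l = 0\<close>, the derivative is a unit times \<open>a ^ (s1 - 1)\<close>, a pole wherever
  \<open>a\<close> is one.\<close>

lemma multiplier_cases:
  assumes a: "a \<notin> Fp_bar"
  shows "poly (pderiv (G ^ q)) a = 0 \<or> poly (pderiv (G ^ q)) a \<notin> Fp_bar"
proof (cases "l = 0")
  case False
  then have "of_nat q = (0 :: 'k)" by (simp add: q_def)
  moreover have "pderiv (G ^ q) = smult (of_nat q) (G ^ (q - 1)) * pderiv G"
    using q_pos pderiv_power_Suc[of G "q - 1"] by simp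
  ultimately show ?thesis by simp
next
  case True
  then have q: "q = 1" unfolding q_def by simp
  obtain V where V: "valuation_ring V" "a \<notin> V" using exists_valuation_ring[OF prime_CHAR a] by blast
  then interpret two_term_valuation b1 b2 l k s1 s2 V by (intro valuation)
  have "vlt 1 (a ^ (s1 - 1))"
    using V s1_bounds(3) by (intro one_vlt_power) (auto simp: vlt_def vle_one_iff)
  also have "a ^ (s1 - 1) = 1 * 1 * a ^ (s1 - 1)" by simp
  also have "veq \<dots> (of_nat s1 * b1 * a ^ (s1 - 1))"
    by (intro veq_mult veq_sym[OF s1_unit] veq_sym[OF b1_unit]) auto
  also have "\<dots> = poly (pderiv (G ^ q)) a" by (simp add: q pderiv_G poly_monom)
  finally show ?thesis
    using Fp_bar_subset[OF prime_CHAR] by (auto simp: vlt_def vle_one_iff)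
qed

text \<open>At a parameter fixing \<open>a\<close> the chain rule multiplies by the same multiplier
  and adds \<open>1\<close> at each step, which builds a geometric sum.\<close>

lemma pderiv_orbit_poly:
  assumes c: "f a + c = a"
  shows "poly (pderiv (orbit_poly a n)) c = (\<Sum>i<n. poly (pderiv (G ^ q)) a ^ i)"
proof (induction n)
  case (Suc n)
  have "((\<lambda>x. f x + c) ^^ n) a = a" by (induction n) (use c in auto)
  then have "poly (orbit_poly a n) c = a" by (simp add: poly_orbit_poly)
  then have "poly (pderiv (orbit_poly a (Suc n))) c =
      poly (pderiv (G ^ q)) a * (\<Sum>i<n. poly (pderiv (G ^ q)) a ^ i) + 1"
    using Suc by (simp add: pderiv_add pderiv_pcompose poly_pcompose pderiv_pCons)
  then show ?case by (simp add: sum.lessThan_Suc_shift sum_distrib_left del: sum.lessThan_Suc)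
qed (simp add: pderiv_pCons)

text \<open>
  The parameter fixing \<open>a\<close> is a simple root of the equation for period \<open>n\<close>, whose degree
  exceeds one, so there is another root.
\<close>
lemma exists_nonfixed_periodic_parameter:
  assumes a: "a \<notin> Fp_bar" and n: "n \<ge> 2"
  shows "\<exists>c. ((\<lambda>x. f x + c) ^^ n) a = a \<and> f a + c \<noteq> a"
proof -
  define c0 where "c0 = a - f a"
  define \<mu> where "\<mu> = poly (pderiv (G ^ q)) a"
  define P where "P = orbit_poly a n - [:a:]"
  have c0: "f a + c0 = a" by (simp add: c0_def)
  have "((\<lambda>x. f x + c0) ^^ n) a = a" by (induction n) (use c0 in auto)
  then have "poly P c0 = 0" by (simp add: P_def poly_orbit_poly)
  then obtain Q where Q: "P = [:- c0, 1:] * Q" using poly_eq_0_iff_dvd by (metis dvdE)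
  obtain j where j: "n = Suc (Suc j)" using n by (metis add_2_eq_Suc le_Suc_ex)
  have "1 < d ^ Suc j" using d_gt by (intro one_less_power) auto
  moreover have "Polynomial.degree (orbit_poly a n) = d ^ Suc j" unfolding j by (rule degree_orbit_poly)
  ultimately have *: "1 < Polynomial.degree (orbit_poly a n)" by simp
  then have "Polynomial.degree (orbit_poly a n + [:- a:]) = Polynomial.degree (orbit_poly a n)"
    by (intro degree_add_eq_left) simp
  moreover have "P = orbit_poly a n + [:- a:]" by (simp add: P_def)
  ultimately have deg: "Polynomial.degree P > 1" using * by simp
  have "Q \<noteq> 0"
  proof
    assume "Q = 0"
    then have "P = 0" using Q by simp
    with deg show False by simp
  qed
  then have "Polynomial.degree P = 1 + Polynomial.degree Q" unfolding Q by (subst degree_mult_eq) auto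
  with deg obtain c where c: "poly Q c = 0" using alg_closed_imp_poly_has_root[of Q] by auto
  have sum: "poly (pderiv P) c0 = (\<Sum>i<n. \<mu> ^ i)"
    unfolding P_def \<mu>_def using pderiv_orbit_poly[OF c0] by (simp add: pderiv_diff pderiv_pCons)
  \<comment> \<open>The sum is \<open>1\<close> for \<open>\<mu> = 0\<close>; otherwise its
    vanishing would make the transcendental \<open>\<mu>\<close> a root of unity. This gives
    simplicity of the root \<open>c0\<close>.\<close>
  have "(\<Sum>i<n. \<mu> ^ i) \<noteq> 0"
  proof (cases "\<mu> = 0")
    case True
    then show ?thesis using n by (simp add: power_0_left sum.delta if_distrib cong: if_cong)
  next
    case False
    then have "\<mu> \<notin> Fp_bar" using multiplier_cases[OF a] by (simp add: \<mu>_def)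
    then obtain V where V: "valuation_ring V" "\<mu> \<notin> V" using exists_valuation_ring[OF prime_CHAR] by blast
    then interpret valuation_ring V by simp
    show ?thesis
    proof
      assume "(\<Sum>i<n. \<mu> ^ i) = 0"
      then have "\<mu> ^ n = 1" using power_diff_1_eq[of \<mu> n] by simp
      then have "veq \<mu> 1" using n by (intro veq_one_if_power_eq_one) auto
      with V show False by (simp add: veq_def vle_one_iff)
    qed
  qed
  then have "poly Q c0 \<noteq> 0" using sum unfolding Q poly_pderiv_linear_mult by simp
  with c have "c \<noteq> c0" by auto
  moreover have "poly P c = 0" using c Q by simp
  ultimately show ?thesis
    by (intro exI[of _ c]) (auto simp: P_def poly_orbit_poly c0_def algebra_simps)
qed

text \<open>Each prime \<open>n\<close> gets a parameter of period \<open>n\<close> that does not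
  fix \<open>a\<close>. A parameter shared by two primes would have coprime periods and so fix
  \<open>a\<close>.\<close>

lemma infinite_if_transcendental:
  assumes a: "a \<notin> Fp_bar"
  shows "infinite {c. preperiodic (\<lambda>x. f x + c) a}"
proof -
  obtain c where c: "\<And>n. n \<ge> 2 \<Longrightarrow> ((\<lambda>x. f x + c n) ^^ n) a = a \<and> f a + c n \<noteq> a"
    using exists_nonfixed_periodic_parameter[OF a] by metis
  let ?primes = "{n :: nat. Factorial_Ring.prime n}"
  have "inj_on c ?primes"
  proof (rule inj_onI, rule ccontr)
    fix i j assume ij: "i \<in> ?primes" "j \<in> ?primes" "c i = c j" "i \<noteq> j"
    then have "coprime i j" using primes_coprime by simp
    moreover have "i \<ge> 2" "j \<ge> 2" using ij prime_ge_2_nat by auto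
    ultimately have "f a + c i = a"
      using c[of i] c[of j] ij(3) fixed_if_coprime_periods[of i "\<lambda>x. f x + c i" a j] by simp
    with c[OF \<open>i \<ge> 2\<close>] show False by simp
  qed
  then have "infinite (c ` ?primes)" using primes_infinite finite_imageD by blast
  moreover have "c ` ?primes \<subseteq> {c. preperiodic (\<lambda>x. f x + c) a}"
  proof clarify
    fix n :: nat assume "Factorial_Ring.prime n"
    then have "n \<ge> 2" by (rule prime_ge_2_nat)
    then show "preperiodic (\<lambda>x. f x + c n) a"
      using c by (intro periodic_imp_preperiodic[of n]) auto
  qed
  ultimately show ?thesis using finite_subset by blast
qed

lemma infinite_preperiodic_iff:
  "infinite {c. preperiodic (\<lambda>x. f x + c) a \<and> preperiodic (\<lambda>x. f x + c) b} \<longleftrightarrow>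
    (a \<in> Fp_bar \<and> b \<in> Fp_bar) \<or> f a = f b" (is "infinite ?\<Lambda> \<longleftrightarrow> _")
proof
  assume inf: "infinite ?\<Lambda>"
  show "(a \<in> Fp_bar \<and> b \<in> Fp_bar) \<or> f a = f b"
  proof (cases "a \<in> Fp_bar")
    case True
    from inf obtain c where "c \<in> ?\<Lambda>" using infinite_imp_nonempty by blast
    with True show ?thesis using Fp_bar_transfer by blast
  next
    case False
    with inf show ?thesis using f_eq_if_infinite by blast
  qed
next
  have alg: "infinite ?\<Lambda>" if "a \<in> Fp_bar" "b \<in> Fp_bar"
  proof -
    have "Fp_bar \<subseteq> ?\<Lambda>" using preperiodic_Fp_bar that by blast
    then show ?thesis using infinite_Fp_bar[OF prime_CHAR] finite_subset by blast
  qed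
  assume "(a \<in> Fp_bar \<and> b \<in> Fp_bar) \<or> f a = f b"
  \<comment> \<open>If the images agree and \<open>a\<close> is algebraic over the prime field, then
    so is \<open>b\<close>, which leads back to the first case.\<close>
  then consider "a \<in> Fp_bar" "b \<in> Fp_bar" | "f a = f b" "a \<notin> Fp_bar"
    using Fp_bar_fibre by blast
  then show "infinite ?\<Lambda>"
  proof cases
    case 1
    then show ?thesis by (rule alg)
  next
    case 2
    have "preperiodic (\<lambda>x. f x + c) a \<longleftrightarrow> preperiodic (\<lambda>x. f x + c) b" for c
      using preperiodic_iff_step[of "\<lambda>x. f x + c" a] preperiodic_iff_step[of "\<lambda>x. f x + c" b]
      unfolding 2(1) by blast
    then have "?\<Lambda> = {c. preperiodic (\<lambda>x. f x + c) a}" by simp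
    then show ?thesis using infinite_if_transcendental[OF 2(2)] by simp
  qed
qed

end

section \<open>Reduction of the given polynomial to the normal form\<close>

theorem theorem4p3:
  fixes p d1 d2 l1 l2 s1 s2 :: nat
    and c1 c2 :: "'a :: field alg_closure"
    and f :: "'a alg_closure poly"
    and \<alpha> \<beta> :: 'a
  assumes "Factorial_Ring.prime p" and "CHAR('a) = p"
    and "c1 \<in> Fp_bar - {0}" and "c2 \<in> Fp_bar - {0}"
    and "1 \<le> d1" and "d1 < d2"
    and "f = Polynomial.monom c1 d1 + Polynomial.monom c2 d2"
    and "d1 = p ^ l1 * s1" and "\<not> p dvd s1"
    and "d2 = p ^ l2 * s2" and "\<not> p dvd s2"
    and "s2 > 1"
    and "p ^ l2 * (s2 - 1) < p ^ l1 * (s1 - 1)"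
  shows "infinite (Prep f (to_ac \<alpha>) (to_ac \<beta>)) \<longleftrightarrow>
           (to_ac \<alpha> \<in> Fp_bar \<and> to_ac \<beta> \<in> Fp_bar) \<or>
           poly f (to_ac \<alpha>) = poly f (to_ac \<beta>)"
proof -
  have char: "CHAR('a alg_closure) = p" using assms(2) by simp
  have prime: "Factorial_Ring.prime CHAR('a alg_closure)" using assms(1) char by simp
  have p0: "p ^ l1 > 0" using assms(1) by (simp add: prime_gt_0_nat)
  \<comment> \<open>The coefficients are replaced by their \<open>p ^ l1\<close>-th roots; such a
    root has the Frobenius period of the coefficient, since Frobenius is injective.\<close>
  have root: "\<exists>b. b ^ (p ^ l1) = c \<and> b \<in> Fp_bar \<and> b \<noteq> 0" if c: "c \<in> Fp_bar - {0}" for c :: "'a alg_closure"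
  proof -
    obtain b where b: "b ^ (p ^ l1) = c" using nth_root_exists[OF p0] by blast
    obtain j where j: "j > 0" "c ^ (p ^ j) = c" using Fp_bar_iff[OF prime, of c] c char by auto
    have "(b ^ (p ^ j)) ^ (CHAR('a alg_closure) ^ l1) = (b ^ (p ^ l1)) ^ (p ^ j)"
      unfolding char by (simp add: power_mult [symmetric] mult.commute)
    also have "\<dots> = b ^ (CHAR('a alg_closure) ^ l1)" using b j char by simp
    finally have "b ^ (p ^ j) = b" by (rule power_CHAR_power_inj[OF prime])
    then have "b \<in> Fp_bar" using Fp_bar_iff[OF prime, of b] j char by auto
    moreover have "b \<noteq> 0" using b c p0 by (auto simp: power_0_left)
    ultimately show ?thesis using b by blast
  qed
  obtain b1 b2 where b1: "b1 ^ (p ^ l1) = c1" "b1 \<in> Fp_bar" "b1 \<noteq> 0"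
    and b2: "b2 ^ (p ^ l1) = c2" "b2 \<in> Fp_bar" "b2 \<noteq> 0"
    using root[OF assms(3)] root[OF assms(4)] by blast
  obtain t1 t2 where t: "s1 = Suc t1" "s2 = Suc t2" using assms(5,8,12) by (cases s1; cases s2) auto
  \<comment> \<open>Adding \<open>d1 < d2\<close> to the inequality on the exponents cancels
    everything except the two powers of \<open>p\<close>.\<close>
  have "p ^ l1 < p ^ l2" using assms(6,8,10,13) unfolding t by simp
  then have l: "l1 < l2" using assms(1) prime_gt_1_nat by (metis power_strict_increasing_iff)
  define k where "k = l2 - l1"
  have k: "p ^ l2 = p ^ l1 * p ^ k" using l by (simp add: k_def power_add [symmetric])
  have "p ^ k * (s2 - 1) < s1 - 1" using assms(13) p0 unfolding k by (simp add: mult.assoc)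
  moreover have "s1 < p ^ k * s2" using assms(6,8,10) p0 unfolding k by (simp add: mult.assoc)
  ultimately interpret T: two_term b1 b2 l1 k s1 s2
    by unfold_locales (use prime b1 b2 assms(9,12) l char in \<open>auto simp: k_def\<close>)
  have f_eq: "poly f x = T.f x" for x
  proof -
    have "(b1 * x ^ s1 + b2 * x ^ T.m) ^ T.q = (b1 * x ^ s1) ^ T.q + (b2 * x ^ T.m) ^ T.q"
      using prime by (rule freshmans_dream') (simp add: T.q_def)
    also have "\<dots> = c1 * x ^ d1 + c2 * x ^ d2"
      unfolding b1(1) [symmetric] b2(1) [symmetric] assms(8,10) k T.q_def T.m_def T.r_def char
      by (simp add: power_mult_distrib power_mult [symmetric] ac_simps)
    finally show ?thesis
      by (simp add: assms(7) poly_monom T.f_def T.g_altdef)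
  qed
  have "Prep f (to_ac \<alpha>) (to_ac \<beta>) =
      {c. preperiodic (\<lambda>x. T.f x + c) (to_ac \<alpha>) \<and>
        preperiodic (\<lambda>x. T.f x + c) (to_ac \<beta>)}"
  proof -
    have "poly (f + [:c:]) = (\<lambda>x. T.f x + c)" for c by (rule ext) (simp add: f_eq)
    then show ?thesis by (simp add: Prep_def)
  qed
  then show ?thesis using T.infinite_preperiodic_iff[of "to_ac \<alpha>" "to_ac \<beta>"] by (simp only: f_eq)
qed

end
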